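(* Let $(W,S)$ be a Coxeter system whose Coxeter diagram $\Delta$ is a cycle of $n>3$ odd edges, with nodes labeled $s_0,\dots,s_{n-1}$ in cyclic order and the subscripts of the $s_i$ read modulo $n$ (so $o(s_is_{i+1})$ is odd for every $i$, and $o(s_is_j)=2$ whenever $i\not\equiv j,\,j\pm1$ modulo $n$). Let $s\in S$, and let $W_\Omega$ and $\Gamma_\Omega$ be as in the context. Then $W_\Omega$ has a presentation with generators $S_i$, $i\in\mathbb{Z}$, and relations (i) $(S_iS_j)^{o(s_is_j)}=1$ if $|i-j|\le n-4$; (ii) $(S_iS_{i+2-n})^2=1$ if $\{s_i,s_{i+1},s_{i+2}\}$ has type $H_3$; (iii) $S_i=S_{i+2-n}$ if $\{s_i,s_{i+1},s_{i+2}\}$ has type $A_3$. A generator for $\Gamma_\Omega$ acts (by conjugation on $W_\Omega$) by $S_i\mapsto S_{i+n}$ for all $i\in\mathbb{Z}$.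
   Context: A Coxeter system $(W,S)$ is a group $W$ with a generating set $S$ of involutions such that the relations $(ss')^{o(ss')}=1$ ($s,s'\in S$) present $W$, where $o(x)$ is the order of $x$ (so $o(s_is_i)=1$). The Coxeter diagram has vertex set $S$, with distinct $s,s'$ joined by an edge labeled $o(ss')$, edges labeled $2$ being omitted. The label $\infty$ is neither even nor odd. Here the generators $S_i$ are indexed by integers, not by residues modulo $n$. The set $\{s_i,s_{i+1},s_{i+2}\}$ has type $A_3$ if both edges joining consecutive elements are labeled $3$, and type $H_3$ if one of these edges is labeled $3$ and the other $5$. A reflection in $W$ is an element conjugate into $S$. $W_\Omega$ is the subgroup of the centralizer $C_W(s)$ generated by all the reflections it contains except $s$. $\Delta^{\rm odd}$ is the graph with vertex set $S$ and distinct $t,t'$ joined iff $o(tt')$ is odd. For an edge-path $\gamma=(t_0,\dots,t_k)$ in $\Delta^{\rm odd}$, with $2l_i+1=o(t_{i-1}t_i)$, set $p_\gamma:=(t_1t_0)^{l_1}(t_2t_1)^{l_2}\cdots(t_kt_{k-1})^{l_k}$, with $p_\gamma=1$ if $k=0$. $\Gamma_\Omega$ is the subgroup of $W$ generated by the $p_\gamma$ with $\gamma$ an edge-loop in $\Delta^{\rm odd}$ based at $s$. One has $C_W(s)=\langle s\rangle\times(W_\Omega\rtimes\Gamma_\Omega)$. *)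

theory Defs
  imports "HOL-Algebra.Multiplicative_Group" "HOL-Algebra.Generated_Groups" "HOL-Number_Theory.Cong"
begin

section \<open>Group presentations\<close>

text \<open>Words over the alphabet of generators and formal inverses: \<open>(x, True)\<close> stands for the
  generator \<open>x\<close> and \<open>(x, False)\<close> for its formal inverse.\<close>

type_synonym 'x word = "('x \<times> bool) list"

abbreviation gen :: "'x \<Rightarrow> 'x \<times> bool" where
  "gen x \<equiv> (x, True)"

abbreviation gen_inv :: "'x \<Rightarrow> 'x \<times> bool" where
  "gen_inv x \<equiv> (x, False)"

definition words :: "'x set \<Rightarrow> 'x word set" where
  "words X = lists (X \<times> UNIV)"

definition word_pow :: "'x word \<Rightarrow> nat \<Rightarrow> 'x word" where
  "word_pow w k = concat (replicate k w)"

inductive word_equiv :: "'x set \<Rightarrow> 'x word set \<Rightarrow> 'x word \<Rightarrow> 'x word \<Rightarrow> bool"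
  for X :: "'x set" and R :: "'x word set" where
  word_equiv_refl: "w \<in> words X \<Longrightarrow> word_equiv X R w w"
| word_equiv_sym: "word_equiv X R u v \<Longrightarrow> word_equiv X R v u"
| word_equiv_trans: "word_equiv X R u v \<Longrightarrow> word_equiv X R v w \<Longrightarrow> word_equiv X R u w"
| word_equiv_cancel: "u \<in> words X \<Longrightarrow> v \<in> words X \<Longrightarrow> x \<in> X \<Longrightarrow>
    word_equiv X R (u @ [(x, b), (x, \<not> b)] @ v) (u @ v)"
| word_equiv_relator: "u \<in> words X \<Longrightarrow> v \<in> words X \<Longrightarrow> r \<in> R \<Longrightarrow> r \<in> words X \<Longrightarrow>
    word_equiv X R (u @ r @ v) (u @ v)"

definition word_rel :: "'x set \<Rightarrow> 'x word set \<Rightarrow> ('x word \<times> 'x word) set" where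
  "word_rel X R = {(u, v). word_equiv X R u v}"

definition word_class :: "'x set \<Rightarrow> 'x word set \<Rightarrow> 'x word \<Rightarrow> 'x word set" where
  "word_class X R w = word_rel X R `` {w}"

definition presented_group :: "'x set \<Rightarrow> 'x word set \<Rightarrow> 'x word set monoid" where
  "presented_group X R =
    \<lparr>carrier = words X // word_rel X R,
     monoid.mult = (\<lambda>A B. \<Union>u\<in>A. \<Union>v\<in>B. word_class X R (u @ v)),
     one = word_class X R []\<rparr>"

text \<open>\<open>has_presentation G X \<phi> R\<close>: the group \<open>G\<close> is presented by the generators \<open>\<phi> x\<close>, \<open>x \<in> X\<close>,
  subject to the relators \<open>R\<close>. The map \<open>\<phi>\<close> is not required to be injective.\<close>

definition has_presentation ::
    "('g, 'm) monoid_scheme \<Rightarrow> 'x set \<Rightarrow> ('x \<Rightarrow> 'g) \<Rightarrow> 'x word set \<Rightarrow> bool" where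
  "has_presentation G X \<phi> R \<longleftrightarrow>
     group G \<and> R \<subseteq> words X \<and>
     (\<exists>h \<in> iso (presented_group X R) G. \<forall>x\<in>X. h (word_class X R [gen x]) = \<phi> x)"

lemma words_simps [simp]:
  "[] \<in> words X"
  "u @ v \<in> words X \<longleftrightarrow> u \<in> words X \<and> v \<in> words X"
  "a # u \<in> words X \<longleftrightarrow> fst a \<in> X \<and> u \<in> words X"
  by (auto simp: words_def mem_Times_iff)

lemma word_equiv_words:
  "word_equiv X R u v \<Longrightarrow> u \<in> words X \<and> v \<in> words X"
  by (induction rule: word_equiv.induct) auto

lemma equiv_word_rel: "equiv (words X) (word_rel X R)"
proof (rule equivI)
  show "word_rel X R \<subseteq> words X \<times> words X"
    by (auto simp: word_rel_def dest: word_equiv_words)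
  show "refl_on (words X) (word_rel X R)"
    by (simp add: word_rel_def refl_on_def word_equiv_refl)
  show "sym (word_rel X R)"
    by (rule symI) (simp add: word_rel_def word_equiv_sym)
  show "trans (word_rel X R)"
    unfolding word_rel_def by (rule transI) (blast intro: word_equiv_trans)
qed

lemma word_equiv_append_left:
  "word_equiv X R u v \<Longrightarrow> w \<in> words X \<Longrightarrow> word_equiv X R (w @ u) (w @ v)"
proof (induction rule: word_equiv.induct)
  case (word_equiv_cancel u v x b)
  then show ?case using word_equiv.word_equiv_cancel[of "w @ u" X v x R b] by simp
next
  case (word_equiv_relator u v r)
  then show ?case using word_equiv.word_equiv_relator[of "w @ u" X v r R] by simp
next
  case (word_equiv_sym u v)
  then show ?case by (blast intro: word_equiv.word_equiv_sym)
next
  case (word_equiv_trans u v v')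
  then show ?case by (blast intro: word_equiv.word_equiv_trans)
qed (simp add: word_equiv_refl)

lemma word_equiv_append_right:
  "word_equiv X R u v \<Longrightarrow> w \<in> words X \<Longrightarrow> word_equiv X R (u @ w) (v @ w)"
proof (induction rule: word_equiv.induct)
  case (word_equiv_cancel u v x b)
  then show ?case using word_equiv.word_equiv_cancel[of u X "v @ w" x R b] by simp
next
  case (word_equiv_relator u v r)
  then show ?case using word_equiv.word_equiv_relator[of u X "v @ w" r R] by simp
next
  case (word_equiv_sym u v)
  then show ?case by (blast intro: word_equiv.word_equiv_sym)
next
  case (word_equiv_trans u v v')
  then show ?case by (blast intro: word_equiv.word_equiv_trans)
qed (simp add: word_equiv_refl)

lemma word_equiv_append:
  assumes "word_equiv X R u u'" "word_equiv X R v v'"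
  shows "word_equiv X R (u @ v) (u' @ v')"
proof (rule word_equiv_trans)
  show "word_equiv X R (u @ v) (u' @ v)"
    using assms word_equiv_append_right word_equiv_words by blast
  show "word_equiv X R (u' @ v) (u' @ v')"
    using assms word_equiv_append_left word_equiv_words by blast
qed

lemma word_class_eq_iff:
  assumes "u \<in> words X" "v \<in> words X"
  shows "word_class X R u = word_class X R v \<longleftrightarrow> word_equiv X R u v"
  using eq_equiv_class_iff[OF equiv_word_rel assms] by (simp add: word_class_def word_rel_def)

lemma mult_word_class:
  assumes "u \<in> words X" "v \<in> words X"
  shows "word_class X R u \<otimes>\<^bsub>presented_group X R\<^esub> word_class X R v = word_class X R (u @ v)"
proof -
  have "word_class X R (u' @ v') = word_class X R (u @ v)"
    if "u' \<in> word_class X R u" "v' \<in> word_class X R v" for u' v'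
  proof -
    from that have "word_equiv X R u u'" "word_equiv X R v v'"
      by (simp_all add: word_class_def word_rel_def)
    then have *: "word_equiv X R (u @ v) (u' @ v')" by (rule word_equiv_append)
    note ** = word_equiv_words[OF this]
    show ?thesis
      using word_class_eq_iff[OF **[THEN conjunct2] **[THEN conjunct1]] word_equiv_sym[OF *]
      by simp
  qed
  then have "(\<Union>u'\<in>word_class X R u. \<Union>v'\<in>word_class X R v. word_class X R (u' @ v')) =
      (\<Union>u'\<in>word_class X R u. \<Union>v'\<in>word_class X R v. word_class X R (u @ v))"
    by (intro SUP_cong[OF refl])
  moreover have "u \<in> word_class X R u" "v \<in> word_class X R v"
    using assms by (simp_all add: word_class_def word_rel_def word_equiv_refl)
  ultimately show ?thesis
    by (auto simp: presented_group_def)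
qed

lemma carrier_presented_group:
  "carrier (presented_group X R) = word_class X R ` words X"
  by (auto simp: presented_group_def quotient_def word_class_def)

lemma one_presented_group:
  "\<one>\<^bsub>presented_group X R\<^esub> = word_class X R []"
  by (simp add: presented_group_def)

lemma word_equiv_left_inverse:
  assumes "w \<in> words X"
  shows "word_equiv X R (rev (map (\<lambda>(x, b). (x, \<not> b)) w) @ w) []"
  using assms
proof (induction w)
  case Nil
  then show ?case by (simp add: word_equiv_refl)
next
  case (Cons a w)
  obtain x b where a: "a = (x, b)" by (cases a)
  let ?w' = "rev (map (\<lambda>(x, b). (x, \<not> b)) w)"
  have w: "w \<in> words X" "x \<in> X" using Cons.prems a by auto
  have IH: "word_equiv X R (?w' @ w) []" using Cons.IH w by blast
  then have "?w' \<in> words X" by (auto dest: word_equiv_words)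
  from word_equiv_cancel[OF this w(1) w(2), of R "\<not> b"]
  have "word_equiv X R (?w' @ [(x, \<not> b), (x, b)] @ w) (?w' @ w)" by simp
  from word_equiv_trans[OF this IH] show ?case using a by simp
qed

lemma group_presented_group: "group (presented_group X R)"
proof (rule groupI)
  fix A assume "A \<in> carrier (presented_group X R)"
  then obtain w where w: "w \<in> words X" "A = word_class X R w"
    by (auto simp: carrier_presented_group)
  let ?w' = "rev (map (\<lambda>(x, b). (x, \<not> b)) w)"
  have *: "word_equiv X R (?w' @ w) []" by (rule word_equiv_left_inverse[OF w(1)])
  then have "?w' \<in> words X" by (auto dest: word_equiv_words)
  with * w show "\<exists>B\<in>carrier (presented_group X R).
      B \<otimes>\<^bsub>presented_group X R\<^esub> A = \<one>\<^bsub>presented_group X R\<^esub>"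
    by (intro bexI[of _ "word_class X R ?w'"])
      (auto simp: carrier_presented_group mult_word_class one_presented_group word_class_eq_iff)
qed (auto simp: carrier_presented_group mult_word_class one_presented_group)


section \<open>Coxeter systems\<close>

text \<open>\<^const>\<open>group.ord\<close> is \<open>0\<close> on elements of infinite order, so pairs with label \<open>\<infinity>\<close> contribute
  no relator, and a label \<open>\<infinity>\<close> is not odd.\<close>

definition coxeter_label :: "('g, 'm) monoid_scheme \<Rightarrow> 'g \<Rightarrow> 'g \<Rightarrow> nat" where
  "coxeter_label W s t = group.ord W (s \<otimes>\<^bsub>W\<^esub> t)"

definition coxeter_relators :: "('g, 'm) monoid_scheme \<Rightarrow> 'g set \<Rightarrow> 'g word set" where
  "coxeter_relators W S =
    {word_pow [gen s, gen t] (coxeter_label W s t) | s t.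
       s \<in> S \<and> t \<in> S \<and> coxeter_label W s t \<noteq> 0}"

definition coxeter_system :: "('g, 'm) monoid_scheme \<Rightarrow> 'g set \<Rightarrow> bool" where
  "coxeter_system W S \<longleftrightarrow>
     group W \<and> S \<subseteq> carrier W \<and> generate W S = carrier W \<and>
     (\<forall>s\<in>S. group.ord W s = 2) \<and>
     has_presentation W S (\<lambda>s. s) (coxeter_relators W S)"

definition diagram_edge :: "('g, 'm) monoid_scheme \<Rightarrow> 'g set \<Rightarrow> 'g \<Rightarrow> 'g \<Rightarrow> bool" where
  "diagram_edge W S s t \<longleftrightarrow> s \<in> S \<and> t \<in> S \<and> s \<noteq> t \<and> coxeter_label W s t \<noteq> 2"

definition odd_edge :: "('g, 'm) monoid_scheme \<Rightarrow> 'g set \<Rightarrow> 'g \<Rightarrow> 'g \<Rightarrow> bool" where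
  "odd_edge W S s t \<longleftrightarrow> s \<in> S \<and> t \<in> S \<and> s \<noteq> t \<and> odd (coxeter_label W s t)"

text \<open>The diagram is a cycle of \<open>n\<close> odd edges with nodes \<open>a 0, \<dots>, a (n - 1)\<close> in cyclic order; the
  labelling \<open>a\<close> is extended \<open>n\<close>-periodically to all integers.\<close>

definition odd_cycle_diagram ::
    "('g, 'm) monoid_scheme \<Rightarrow> 'g set \<Rightarrow> nat \<Rightarrow> (int \<Rightarrow> 'g) \<Rightarrow> bool" where
  "odd_cycle_diagram W S n a \<longleftrightarrow>
     range a = S \<and>
     (\<forall>i j. a i = a j \<longleftrightarrow> [i = j] (mod int n)) \<and>
     (\<forall>i j. diagram_edge W S (a i) (a j) \<longleftrightarrow>
        [j = i + 1] (mod int n) \<or> [j = i - 1] (mod int n)) \<and>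
     (\<forall>i. odd (coxeter_label W (a i) (a (i + 1))))"

definition type_A3 :: "('g, 'm) monoid_scheme \<Rightarrow> 'g \<Rightarrow> 'g \<Rightarrow> 'g \<Rightarrow> bool" where
  "type_A3 W s t u \<longleftrightarrow> coxeter_label W s t = 3 \<and> coxeter_label W t u = 3"

definition type_H3 :: "('g, 'm) monoid_scheme \<Rightarrow> 'g \<Rightarrow> 'g \<Rightarrow> 'g \<Rightarrow> bool" where
  "type_H3 W s t u \<longleftrightarrow>
     coxeter_label W s t = 3 \<and> coxeter_label W t u = 5 \<or>
     coxeter_label W s t = 5 \<and> coxeter_label W t u = 3"


section \<open>Centralizers of reflections\<close>

definition reflections :: "('g, 'm) monoid_scheme \<Rightarrow> 'g set \<Rightarrow> 'g set" where
  "reflections W S = {w \<otimes>\<^bsub>W\<^esub> s \<otimes>\<^bsub>W\<^esub> inv\<^bsub>W\<^esub> w | w s. w \<in> carrier W \<and> s \<in> S}"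

definition centralizer :: "('g, 'm) monoid_scheme \<Rightarrow> 'g \<Rightarrow> 'g set" where
  "centralizer W s = {w \<in> carrier W. w \<otimes>\<^bsub>W\<^esub> s = s \<otimes>\<^bsub>W\<^esub> w}"

definition W_Omega :: "('g, 'm) monoid_scheme \<Rightarrow> 'g set \<Rightarrow> 'g \<Rightarrow> 'g set" where
  "W_Omega W S s = generate W (reflections W S \<inter> centralizer W s - {s})"

text \<open>An edge-path is given by its nonempty list of vertices \<open>[t\<^sub>0, \<dots>, t\<^sub>k]\<close>.\<close>

definition odd_path :: "('g, 'm) monoid_scheme \<Rightarrow> 'g set \<Rightarrow> 'g list \<Rightarrow> bool" where
  "odd_path W S ts \<longleftrightarrow>
     ts \<noteq> [] \<and> set ts \<subseteq> S \<and>
     (\<forall>i. Suc i < length ts \<longrightarrow> odd_edge W S (ts ! i) (ts ! Suc i))"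

fun path_elt :: "('g, 'm) monoid_scheme \<Rightarrow> 'g list \<Rightarrow> 'g" where
  "path_elt W (t # t' # ts) =
     (t' \<otimes>\<^bsub>W\<^esub> t) [^]\<^bsub>W\<^esub> ((coxeter_label W t t' - 1) div 2) \<otimes>\<^bsub>W\<^esub> path_elt W (t' # ts)"
| "path_elt W _ = \<one>\<^bsub>W\<^esub>"

definition Gamma_Omega :: "('g, 'm) monoid_scheme \<Rightarrow> 'g set \<Rightarrow> 'g \<Rightarrow> 'g set" where
  "Gamma_Omega W S s =
     generate W {path_elt W ts | ts. odd_path W S ts \<and> hd ts = s \<and> last ts = s}"


section \<open>The relators for a cycle of odd edges\<close>

definition cycle_relators ::
    "('g, 'm) monoid_scheme \<Rightarrow> nat \<Rightarrow> (int \<Rightarrow> 'g) \<Rightarrow> int word set" where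
  "cycle_relators W n a =
     {word_pow [gen i, gen j] (coxeter_label W (a i) (a j)) | i j. \<bar>i - j\<bar> \<le> int n - 4} \<union>
     {word_pow [gen i, gen (i + 2 - int n)] 2 | i. type_H3 W (a i) (a (i + 1)) (a (i + 2))} \<union>
     {[gen i, gen_inv (i + 2 - int n)] | i. type_A3 W (a i) (a (i + 1)) (a (i + 2))}"

end

theory Submission
  imports Defs "HOL-Library.Function_Algebras"
begin

text \<open>Let \<open>W\<close> act on its geometric representation and lift the vertices of the cycle to \<open>\<int>\<close>. For each
  edge \<open>{s\<^sub>k, s\<^sub>k\<^sub>+\<^sub>1}\<close> the dihedral element \<open>e k\<close> carries the simple root \<open>\<alpha> (k + 1)\<close> to \<open>\<alpha> k\<close>, and the
  products \<open>q k\<close> of these along paths from the base vertex transport any vertex to the base; going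
  once around gives the generator of \<open>\<Gamma>\<^sub>\<Omega>\<close>. The reflection \<open>\<sigma> j\<close> is \<open>s\<^sub>j\<close> transported from any of the
  vertices \<open>j + 2, \<dots>, j + n - 2\<close>, at all of which it commutes with the local simple reflection.

  Generation: a reflection commuting with \<open>s\<^sub>k\<close> has a positive root orthogonal to \<open>\<alpha> k\<close> and having positive
  product with some other simple root. Conjugating by that simple reflection, or by \<open>e\<close> when it is
  adjacent to \<open>s\<^sub>k\<close>, shortens the reflection, so induction on length applies.

  Relations: for vectors \<open>\<beta> j\<close> in a pointed cone whose pairwise products are \<open>- cos (\<pi> / l)\<close> or at most
  \<open>-1\<close>, the abstract Coxeter group with these labels acts faithfully, by the same argument as for the
  geometric representation. The presented group acts on the same space through the roots \<open>\<beta> j\<close> of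
  the \<open>\<sigma> j\<close>. An explicit recursion for the coordinates of the transported roots shows that all products not
  accounted for by the relators are at most \<open>-1\<close>.\<close>

section \<open>Chebyshev polynomials and dihedral groups of reflections\<close>

instantiation "fun" :: (type, real_vector) real_vector
begin

definition scaleR_fun_def: "scaleR r f = (\<lambda>x. r *\<^sub>R f x)"

instance
  by standard (simp_all add: scaleR_fun_def fun_eq_iff algebra_simps)

end

lemma scaleR_fun_apply [simp]: "(r *\<^sub>R f) x = r *\<^sub>R f x"
  by (simp add: scaleR_fun_def)

text \<open>Chebyshev polynomials of the second kind with the index shifted by one:
  \<open>cheb b k\<close> is \<open>U_(k-1)(b)\<close>. They are the coordinates of roots in the
  plane of two unit vectors with product \<open>- b\<close>.\<close>

fun cheb :: "real \<Rightarrow> nat \<Rightarrow> real" where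
  "cheb b 0 = 0"
| "cheb b (Suc 0) = 1"
| "cheb b (Suc (Suc k)) = 2 * b * cheb b (Suc k) - cheb b k"

lemma sin_cheb: "sin t * cheb (cos t) k = sin (real k * t)"
proof (induction "cos t" k rule: cheb.induct)
  case (3 k)
  have "sin (real (Suc (Suc k)) * t) = sin (real (Suc k) * t + t)"
    by (simp add: algebra_simps)
  moreover have "sin (real k * t) = sin (real (Suc k) * t - t)"
    by (simp add: algebra_simps)
  ultimately have "sin (real (Suc (Suc k)) * t) + sin (real k * t) = 2 * cos t * sin (real (Suc k) * t)"
    by (simp add: sin_add sin_diff)
  moreover have "sin t * cheb (cos t) (Suc (Suc k)) = 2 * cos t * (sin t * cheb (cos t) (Suc k)) - sin t * cheb (cos t) k"
    by (simp add: algebra_simps)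
  ultimately show ?case using 3 by simp
qed simp_all

text \<open>For \<open>1 \<le> b\<close> the recursion makes the increments nondecreasing. This
  serves pairs of roots with product at most -1.\<close>

lemma cheb_mono: "1 \<le> b \<Longrightarrow> 0 \<le> cheb b k \<and> cheb b k \<le> cheb b (Suc k)"
proof (induction k)
  case (Suc k)
  then have "0 \<le> cheb b (Suc k)" by linarith
  then have "1 * cheb b (Suc k) \<le> b * cheb b (Suc k)"
    using Suc.prems by (rule mult_right_mono[rotated])
  with Suc show ?case by simp
qed simp

lemma sin_pi_over_pos: "2 \<le> m \<Longrightarrow> 0 < sin (pi / real m)"
  by (rule sin_gt_zero) (auto simp: field_simps)

lemma cheb_cos_pi_nonneg: "\<lbrakk>2 \<le> m; k \<le> m\<rbrakk> \<Longrightarrow> 0 \<le> cheb (cos (pi / real m)) k"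
proof -
  assume m: "2 \<le> m" "k \<le> m"
  have "0 \<le> sin (real k * (pi / real m))"
    using m by (intro sin_ge_zero) (auto simp: field_simps)
  then have "0 \<le> sin (pi / real m) * cheb (cos (pi / real m)) k" by (simp add: sin_cheb)
  then show ?thesis using sin_pi_over_pos[OF m(1)] by (simp add: zero_le_mult_iff)
qed

lemma cheb_cos_pi_eq:
  "2 \<le> m \<Longrightarrow> cheb (cos (pi / real m)) k = sin (real k * (pi / real m)) / sin (pi / real m)"
  using sin_pi_over_pos[of m] sin_cheb[of "pi / real m" k] by (simp add: nonzero_eq_divide_eq mult.commute)

lemma cos_pi_over_bounds: "2 \<le> m \<Longrightarrow> 0 \<le> cos (pi / real m) \<and> cos (pi / real m) < 1"
proof
  assume m: "2 \<le> m"
  show "0 \<le> cos (pi / real m)"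
    using m by (intro cos_ge_zero order.trans[of "- (pi / 2)" 0 "pi / real m"]) (auto simp: field_simps)
  have "cos (pi / real m) < cos 0"
    using m by (intro cos_monotone_0_pi) (auto simp: field_simps)
  then show "cos (pi / real m) < 1" by simp
qed

section \<open>Products of two reflections in a space with a symmetric form\<close>

locale symmetric_form =
  fixes B :: "'v::real_vector \<Rightarrow> 'v \<Rightarrow> real"
  assumes sym: "B u v = B v u"
    and add_left: "B (u + v) w = B u w + B v w"
    and scale_left: "B (r *\<^sub>R u) w = r * B u w"
begin

lemma add_right: "B w (u + v) = B w u + B w v"
  using add_left sym by metis

lemma scale_right: "B w (r *\<^sub>R u) = r * B w u"
  using scale_left sym by metis

lemma minus_left: "B (- u) w = - B u w"
  using scale_left[of "-1" u w] by simp

lemma minus_right: "B w (- u) = - B w u"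
  using scale_right[of w "-1" u] by simp

lemma diff_left: "B (u - v) w = B u w - B v w"
  using add_left[of u "- v" w] minus_left by simp

lemma diff_right: "B w (u - v) = B w u - B w v"
  using add_right[of w u "- v"] minus_right by simp

lemmas form_simps = add_left add_right scale_left scale_right minus_left minus_right diff_left diff_right

definition refl :: "'v \<Rightarrow> 'v \<Rightarrow> 'v" where
  "refl \<alpha> v = v - (2 * B v \<alpha>) *\<^sub>R \<alpha>"

lemma refl_add: "refl \<alpha> (u + v) = refl \<alpha> u + refl \<alpha> v"
  by (simp add: refl_def form_simps algebra_simps)

lemma refl_scale: "refl \<alpha> (r *\<^sub>R u) = r *\<^sub>R refl \<alpha> u"
  by (simp add: refl_def form_simps algebra_simps)

lemma refl_self: "B \<alpha> \<alpha> = 1 \<Longrightarrow> refl \<alpha> \<alpha> = - \<alpha>"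
proof -
  assume "B \<alpha> \<alpha> = 1"
  then have "refl \<alpha> \<alpha> = \<alpha> - 2 *\<^sub>R \<alpha>" by (simp add: refl_def)
  then show ?thesis by (simp add: scaleR_2)
qed

lemma refl_refl [simp]: "B \<alpha> \<alpha> = 1 \<Longrightarrow> refl \<alpha> (refl \<alpha> v) = v"
  by (simp add: refl_def form_simps algebra_simps flip: scaleR_add_left)

lemma refl_isometry: "B \<alpha> \<alpha> = 1 \<Longrightarrow> B (refl \<alpha> u) (refl \<alpha> v) = B u v"
  by (simp add: refl_def form_simps algebra_simps sym[of \<alpha> v] sym[of \<alpha> u])

lemma refl_orth: "B v \<alpha> = 0 \<Longrightarrow> refl \<alpha> v = v"
  by (simp add: refl_def)

text \<open>Alternating product of \<open>k\<close> reflections in which \<beta> acts first. The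
  recursion peels off the factor applied first, \<open>altr_Suc_left\<close> the one applied
  last.\<close>

fun altr :: "'v \<Rightarrow> 'v \<Rightarrow> nat \<Rightarrow> 'v \<Rightarrow> 'v" where
  "altr \<alpha> \<beta> 0 v = v"
| "altr \<alpha> \<beta> (Suc k) v = altr \<beta> \<alpha> k (refl \<beta> v)"

lemma altr_Suc_left: "altr \<alpha> \<beta> (Suc k) v = refl (if even k then \<beta> else \<alpha>) (altr \<alpha> \<beta> k v)"
  by (induction k arbitrary: \<alpha> \<beta> v) simp_all

lemma altr_add: "altr \<alpha> \<beta> k (u + v) = altr \<alpha> \<beta> k u + altr \<alpha> \<beta> k v"
  by (induction k arbitrary: \<alpha> \<beta> u v) (simp_all add: refl_add)

lemma altr_scale: "altr \<alpha> \<beta> k (r *\<^sub>R u) = r *\<^sub>R altr \<alpha> \<beta> k u"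
  by (induction k arbitrary: \<alpha> \<beta> u) (simp_all add: refl_scale)

lemma altr_minus: "altr \<alpha> \<beta> k (- u) = - altr \<alpha> \<beta> k u"
  using altr_scale[of \<alpha> \<beta> k "-1" u] by simp

lemma altr_orth: "\<lbrakk>B v \<alpha> = 0; B v \<beta> = 0\<rbrakk> \<Longrightarrow> altr \<alpha> \<beta> k v = v"
  by (induction k arbitrary: \<alpha> \<beta> v) (simp_all add: refl_orth)

text \<open>The next reflection swaps the roles of the two roots and replaces the coordinates (p, q)
  by (2 b p - q, p), which is the Chebyshev recursion.\<close>

lemma altr_first:
  assumes "B \<alpha> \<alpha> = 1" "B \<beta> \<beta> = 1" "B \<alpha> \<beta> = - b"
  shows "altr \<alpha> \<beta> k \<alpha> = cheb b (Suc k) *\<^sub>R (if even k then \<alpha> else \<beta>) + cheb b k *\<^sub>R (if even k then \<beta> else \<alpha>)"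
proof (induction k)
  case (Suc k)
  have 1: "refl \<beta> (p *\<^sub>R \<alpha> + q *\<^sub>R \<beta>) = (2 * b * p - q) *\<^sub>R \<beta> + p *\<^sub>R \<alpha>" for p q
    using assms by (simp add: refl_add refl_scale refl_self) (simp add: refl_def algebra_simps)
  have 2: "refl \<alpha> (p *\<^sub>R \<beta> + q *\<^sub>R \<alpha>) = (2 * b * p - q) *\<^sub>R \<alpha> + p *\<^sub>R \<beta>" for p q
    using assms by (simp add: refl_add refl_scale refl_self) (simp add: refl_def algebra_simps sym[of \<beta> \<alpha>])
  show ?case
    unfolding altr_Suc_left Suc by (simp add: 1 2)
qed simp

lemma altr_second:
  assumes "B \<alpha> \<alpha> = 1" "B \<beta> \<beta> = 1" "B \<alpha> \<beta> = - b"
  shows "altr \<alpha> \<beta> (Suc k) \<beta> = - (cheb b (Suc k) *\<^sub>R (if even k then \<beta> else \<alpha>) + cheb b k *\<^sub>R (if even k then \<alpha> else \<beta>))"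
proof -
  have "altr \<alpha> \<beta> (Suc k) \<beta> = - altr \<beta> \<alpha> k \<beta>"
    using assms by (simp add: refl_self altr_minus)
  then show ?thesis using altr_first[of \<beta> \<alpha> b k] assms by (simp add: sym[of \<beta> \<alpha>])
qed

text \<open>The Gram determinant 1 - b^2 is nonzero, so the plane splits off orthogonally;
  \<open>x\<close> and \<open>y\<close> solve the 2 by 2 Gram system.\<close>

lemma plane_decomposition:
  assumes "B \<alpha> \<alpha> = 1" "B \<beta> \<beta> = 1" "B \<alpha> \<beta> = - b" "b\<^sup>2 \<noteq> 1"
  obtains w x y where "v = w + x *\<^sub>R \<alpha> + y *\<^sub>R \<beta>" "B w \<alpha> = 0" "B w \<beta> = 0"
proof
  define x where "x = (B v \<alpha> + b * B v \<beta>) / (1 - b\<^sup>2)"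
  define y where "y = (B v \<beta> + b * B v \<alpha>) / (1 - b\<^sup>2)"
  define w where "w = v - x *\<^sub>R \<alpha> - y *\<^sub>R \<beta>"
  have nz: "1 - b\<^sup>2 \<noteq> 0" using assms by simp
  have xy: "x * (1 - b\<^sup>2) = B v \<alpha> + b * B v \<beta>" "y * (1 - b\<^sup>2) = B v \<beta> + b * B v \<alpha>"
    using nz by (simp_all add: x_def y_def)
  show "v = w + x *\<^sub>R \<alpha> + y *\<^sub>R \<beta>" by (simp add: w_def)
  have "(x - y * b) * (1 - b\<^sup>2) = x * (1 - b\<^sup>2) - (y * (1 - b\<^sup>2)) * b"
    by (simp add: algebra_simps)
  also have "\<dots> = B v \<alpha> * (1 - b\<^sup>2)"
    unfolding xy by (simp add: algebra_simps power2_eq_square)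
  finally have "x - y * b = B v \<alpha>" using nz by simp
  then show "B w \<alpha> = 0"
    using assms by (simp add: w_def form_simps sym[of \<beta> \<alpha>])
  have "(y - x * b) * (1 - b\<^sup>2) = y * (1 - b\<^sup>2) - (x * (1 - b\<^sup>2)) * b"
    by (simp add: algebra_simps)
  also have "\<dots> = B v \<beta> * (1 - b\<^sup>2)"
    unfolding xy by (simp add: algebra_simps power2_eq_square)
  finally have "y - x * b = B v \<beta>" using nz by simp
  then show "B w \<beta> = 0"
    using assms by (simp add: w_def form_simps)
qed

lemma cos_pi_over_square: "2 \<le> m \<Longrightarrow> (cos (pi / real m))\<^sup>2 \<noteq> 1"
  using cos_pi_over_bounds[of m] by (auto simp: power2_eq_1_iff)

text \<open>The rotation fixes the orthogonal complement of the plane. On the two roots it is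
  computed by the Chebyshev values at the angles 2 pi + t, 2 pi and 2 pi - t, where t = pi /
  m.\<close>

lemma altr_period:
  assumes "B \<alpha> \<alpha> = 1" "B \<beta> \<beta> = 1" "B \<alpha> \<beta> = - cos (pi / real m)" "2 \<le> m"
  shows "altr \<alpha> \<beta> (2 * m) v = v"
proof -
  note c = cheb_cos_pi_eq[OF assms(4)]
  define t where "t = pi / real m"
  have mt: "real m * t = pi" using assms by (simp add: t_def)
  have s: "sin t \<noteq> 0" using sin_pi_over_pos[OF assms(4)] by (simp add: t_def)
  have "real (Suc (2 * m)) * t = t + 2 * pi" "real (2 * m) * t = 2 * pi"
    using mt by (simp_all add: algebra_simps)
  then have c1: "cheb (cos t) (Suc (2 * m)) = 1" "cheb (cos t) (2 * m) = 0"
    using s unfolding t_def c by simp_all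
  obtain k where k: "2 * m = Suc k" "odd k" using assms(4) by (cases m) auto
  have "real k * t = 2 * pi - t" 
  proof -
    have "real k = 2 * real m - 1" using k by linarith
    then have "real k * t = 2 * (real m * t) - t" by (simp only: left_diff_distrib mult.assoc mult_1)
    then show ?thesis using mt by simp
  qed
  then have "sin (real k * t) = - sin t" by (simp add: sin_diff)
  then have c2: "cheb (cos t) k = - 1"
    using s unfolding t_def c by simp
  note a = assms(1-3)[folded t_def]
  obtain w x y where v: "v = w + x *\<^sub>R \<alpha> + y *\<^sub>R \<beta>" "B w \<alpha> = 0" "B w \<beta> = 0"
    using plane_decomposition[OF assms(1-3) cos_pi_over_square[OF assms(4)]] by metis
  have "altr \<alpha> \<beta> (2 * m) \<alpha> = \<alpha>"
    using altr_first[OF a, of "2 * m"] c1 by simp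
  moreover have "altr \<alpha> \<beta> (2 * m) \<beta> = \<beta>"
    using altr_second[OF a, of k] c1 c2 k by simp
  ultimately show ?thesis
    using v by (simp add: altr_add altr_scale altr_orth)
qed

text \<open>At the odd label 2 l + 1 the Chebyshev value of index 2 l + 1 vanishes and that of index
  2 l is 1, so 2 l reflections turn one root into the other.\<close>

lemma altr_transport_root:
  assumes "B \<alpha> \<alpha> = 1" "B \<beta> \<beta> = 1" "B \<alpha> \<beta> = - cos (pi / real (2 * l + 1))" "1 \<le> l"
  shows "altr \<beta> \<alpha> (2 * l) \<beta> = \<alpha>"
    and "altr \<beta> \<alpha> (2 * l) \<alpha> = - \<beta> - (2 * cos (pi / real (2 * l + 1))) *\<^sub>R \<alpha>"
proof -
  define m where "m = 2 * l + 1"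
  have m: "2 \<le> m" using assms by (simp add: m_def)
  note c = cheb_cos_pi_eq[OF m]
  define t where "t = pi / real m"
  have mt: "real m * t = pi" using m by (simp add: t_def)
  have s: "sin t \<noteq> 0" using sin_pi_over_pos[OF m] by (simp add: t_def)
  have "real (2 * l + 1) * t = pi" "real (2 * l) * t = pi - t"
    using mt by (simp_all add: m_def algebra_simps)
  then have c1: "cheb (cos t) (Suc (2 * l)) = 0" "cheb (cos t) (2 * l) = 1"
    using s unfolding t_def c by (simp_all add: sin_diff)
  obtain k where k: "2 * l = Suc k" "odd k" using assms(4) by (cases l) auto
  have c2: "cheb (cos t) k = 2 * cos t"
    using cheb.simps(3)[of "cos t" k] c1 k by simp
  have a: "B \<beta> \<alpha> = - cos t"
    using assms by (simp add: t_def m_def sym[of \<beta> \<alpha>])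
  show "altr \<beta> \<alpha> (2 * l) \<beta> = \<alpha>"
    using altr_first[OF assms(2,1) a, of "2 * l"] c1 by simp
  have "altr \<beta> \<alpha> (2 * l) \<alpha> = - \<beta> - (2 * cos t) *\<^sub>R \<alpha>"
    using altr_second[OF assms(2,1) a, of k] c1 c2 k by simp
  then show "altr \<beta> \<alpha> (2 * l) \<alpha> = - \<beta> - (2 * cos (pi / real (2 * l + 1))) *\<^sub>R \<alpha>"
    by (simp add: t_def m_def)
qed

lemma altr_transport:
  assumes "B \<alpha> \<alpha> = 1" "B \<beta> \<beta> = 1" "B \<alpha> \<beta> = - cos (pi / real (2 * l + 1))" "1 \<le> l" "B v \<beta> = 0"
  shows "altr \<beta> \<alpha> (2 * l) v = v - (B v \<alpha> / (1 - cos (pi / real (2 * l + 1)))) *\<^sub>R (\<alpha> + \<beta>)"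
proof -
  define c where "c = cos (pi / real (2 * l + 1))"
  have c: "0 \<le> c" "c < 1" using cos_pi_over_bounds[of "2 * l + 1"] assms(4) by (simp_all add: c_def)
  define x where "x = B v \<alpha> / (1 - c\<^sup>2)"
  \<comment> \<open>The vectors of the plane orthogonal to \<beta> are the multiples of \<alpha> + c
    \<beta>, so \<open>w\<close> is the part of \<open>v\<close> orthogonal to the plane.\<close>
  define w where "w = v - x *\<^sub>R (\<alpha> + c *\<^sub>R \<beta>)"
  have "c\<^sup>2 < 1" using c by (simp add: power_less_one_iff abs_square_less_1)
  then have "x * (1 - c\<^sup>2) = B v \<alpha>" by (simp add: x_def)
  then have w: "B w \<alpha> = 0" "B w \<beta> = 0"
    using assms by (simp_all add: w_def c_def form_simps sym[of \<beta> \<alpha>] power2_eq_square algebra_simps)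
  have v: "v = w + x *\<^sub>R (\<alpha> + c *\<^sub>R \<beta>)" by (simp add: w_def)
  note r = altr_transport_root[OF assms(1-4), folded c_def]
  have "altr \<beta> \<alpha> (2 * l) v = w + x *\<^sub>R (- \<beta> - (2 * c) *\<^sub>R \<alpha> + c *\<^sub>R \<alpha>)"
    by (subst v) (simp add: altr_add altr_scale altr_orth w r)
  also have "\<dots> = v - (x * (1 + c)) *\<^sub>R (\<alpha> + \<beta>)"
    by (simp add: w_def algebra_simps)
      (simp only: scaleR_add_left[symmetric], simp add: algebra_simps flip: mult_2)
  also have "x * (1 + c) = B v \<alpha> / (1 - c)"
  proof -
    have "1 - c\<^sup>2 = (1 - c) * (1 + c)" by (simp add: power2_eq_square algebra_simps)
    then show ?thesis using c by (simp add: x_def)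
  qed
  finally show ?thesis by (simp add: c_def)
qed

end

section \<open>Groups generated by reflections\<close>

text \<open>Common ground for two uses: the Coxeter group with its simple roots, and the presented
  group with the roots of the \<sigma> j. Only a relation of exponent \<open>m\<close> is asked for,
  not the exact order, since orders in the presented group are not known beforehand. Two indices may
  name the same generator, as relation (iii) demands.\<close>

locale reflection_group = symmetric_form B + group G
  for B :: "'v::real_vector \<Rightarrow> 'v \<Rightarrow> real" and G :: "('a, 'm) monoid_scheme" (structure) +
  fixes X :: "'x set" and g :: "'x \<Rightarrow> 'a" and \<beta> :: "'x \<Rightarrow> 'v"
    and \<rho> :: "'a \<Rightarrow> 'v \<Rightarrow> 'v" and K :: "'v set"
  assumes gen_closed: "x \<in> X \<Longrightarrow> g x \<in> carrier G"
    and gen_square: "x \<in> X \<Longrightarrow> g x \<otimes> g x = \<one>"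
    and generated: "generate G (g ` X) = carrier G"
    and root_norm: "x \<in> X \<Longrightarrow> B (\<beta> x) (\<beta> x) = 1"
    and rep_one: "\<rho> \<one> v = v"
    and rep_mult: "\<lbrakk>u \<in> carrier G; w \<in> carrier G\<rbrakk> \<Longrightarrow> \<rho> (u \<otimes> w) v = \<rho> u (\<rho> w v)"
    and rep_gen: "x \<in> X \<Longrightarrow> \<rho> (g x) v = refl (\<beta> x) v"
    and pair_cases: "\<lbrakk>x \<in> X; y \<in> X\<rbrakk> \<Longrightarrow> g x = g y \<and> \<beta> x = \<beta> y \<or>
      (\<exists>m\<ge>2. (g x \<otimes> g y) [^] (m::nat) = \<one> \<and> B (\<beta> x) (\<beta> y) = - cos (pi / real m)) \<or>
      B (\<beta> x) (\<beta> y) \<le> -1"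
    and cone_add: "\<lbrakk>v \<in> K; v' \<in> K\<rbrakk> \<Longrightarrow> v + v' \<in> K"
    and cone_scale: "\<lbrakk>0 \<le> r; v \<in> K\<rbrakk> \<Longrightarrow> r *\<^sub>R v \<in> K"
    and cone_root: "x \<in> X \<Longrightarrow> \<beta> x \<in> K"
    and cone_pointed: "\<lbrakk>v \<in> K; - v \<in> K\<rbrakk> \<Longrightarrow> v = 0"
begin

section \<open>Words in the generators, length and descents\<close>

primrec wprod :: "'x list \<Rightarrow> 'a" where
  "wprod [] = \<one>"
| "wprod (x # xs) = g x \<otimes> wprod xs"

lemma wprod_closed [simp]: "set xs \<subseteq> X \<Longrightarrow> wprod xs \<in> carrier G"
  by (induction xs) (auto simp: gen_closed)

lemma wprod_append: "\<lbrakk>set xs \<subseteq> X; set ys \<subseteq> X\<rbrakk> \<Longrightarrow> wprod (xs @ ys) = wprod xs \<otimes> wprod ys"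
  by (induction xs) (auto simp: gen_closed m_assoc)

lemma gen_inverse: "x \<in> X \<Longrightarrow> inv (g x) = g x"
  by (simp add: gen_closed gen_square inv_equality)

lemma wprod_rev: "set xs \<subseteq> X \<Longrightarrow> wprod (rev xs) = inv (wprod xs)"
  by (induction xs) (auto simp: wprod_append gen_closed inv_mult_group gen_inverse)

lemma wprod_surj:
  assumes "w \<in> carrier G"
  shows "\<exists>xs. set xs \<subseteq> X \<and> wprod xs = w"
proof -
  have "w \<in> generate G (g ` X)" using assms generated by simp
  then show ?thesis
  proof (induction rule: generate.induct)
    case one
    show ?case by (rule exI[of _ "[]"]) simp
  next
    case (incl h)
    then obtain x where "x \<in> X" "h = g x" by auto
    then show ?case by (intro exI[of _ "[x]"]) (simp add: gen_closed)
  next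
    case (inv h)
    then obtain x where "x \<in> X" "h = g x" by auto
    then show ?case by (intro exI[of _ "[x]"]) (simp add: gen_closed gen_inverse)
  next
    case (eng h1 h2)
    then obtain xs ys where "set xs \<subseteq> X" "wprod xs = h1" "set ys \<subseteq> X" "wprod ys = h2" by auto
    then show ?case by (intro exI[of _ "xs @ ys"]) (simp add: wprod_append)
  qed
qed

definition len :: "'a \<Rightarrow> nat" where
  "len w = (LEAST k. \<exists>xs. set xs \<subseteq> X \<and> length xs = k \<and> wprod xs = w)"

lemma reduced_word:
  assumes "w \<in> carrier G"
  obtains xs where "set xs \<subseteq> X" "length xs = len w" "wprod xs = w"
proof -
  have "\<exists>k xs. set xs \<subseteq> X \<and> length xs = k \<and> wprod xs = w"
    using wprod_surj[OF assms] by auto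
  from LeastI_ex[OF this] show thesis using that unfolding len_def by blast
qed

lemma len_wprod: "set xs \<subseteq> X \<Longrightarrow> len (wprod xs) \<le> length xs"
  unfolding len_def by (rule Least_le) auto

lemma len_mult_wprod:
  assumes "w \<in> carrier G" "set xs \<subseteq> X"
  shows "len (w \<otimes> wprod xs) \<le> len w + length xs"
proof -
  obtain ys where "set ys \<subseteq> X" "length ys = len w" "wprod ys = w"
    using reduced_word[OF assms(1)] .
  then show ?thesis
    using assms len_wprod[of "ys @ xs"] by (simp add: wprod_append)
qed

lemma len_inv_le: "w \<in> carrier G \<Longrightarrow> len (inv w) \<le> len w"
proof -
  assume w: "w \<in> carrier G"
  obtain ys where "set ys \<subseteq> X" "length ys = len w" "wprod ys = w"
    using reduced_word[OF w] .
  then show ?thesis using len_wprod[of "rev ys"] by (simp add: wprod_rev)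
qed

lemma len_inv: "w \<in> carrier G \<Longrightarrow> len (inv w) = len w"
  using len_inv_le[of w] len_inv_le[of "inv w"] by simp

lemma mult_gen_gen [simp]: "\<lbrakk>w \<in> carrier G; x \<in> X\<rbrakk> \<Longrightarrow> w \<otimes> g x \<otimes> g x = w"
  by (simp add: m_assoc gen_closed gen_square)

lemma ex_descent:
  assumes "w \<in> carrier G" "w \<noteq> \<one>"
  obtains y where "y \<in> X" "len (w \<otimes> g y) < len w"
proof -
  obtain xs where xs: "set xs \<subseteq> X" "length xs = len w" "wprod xs = w"
    using reduced_word[OF assms(1)] .
  with assms have "xs \<noteq> []" by auto
  then obtain ys y where ys: "xs = ys @ [y]" by (metis rev_exhaust)
  then have "w \<otimes> g y = wprod ys"
    using xs by (auto simp: wprod_append gen_closed m_assoc gen_square)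
  then have "len (w \<otimes> g y) < len w" using len_wprod[of ys] xs ys by simp
  then show thesis using that xs ys by auto
qed

lemma rep_wprod_induct:
  assumes "w \<in> carrier G" "P id" "\<And>f x. \<lbrakk>x \<in> X; P f\<rbrakk> \<Longrightarrow> P (\<lambda>v. refl (\<beta> x) (f v))"
  shows "P (\<rho> w)"
proof -
  obtain xs where xs: "set xs \<subseteq> X" "wprod xs = w" using wprod_surj[OF assms(1)] by blast
  have "P (\<rho> (wprod xs))" using xs(1)
  proof (induction xs)
    case Nil
    have "\<rho> \<one> = id" by (simp add: rep_one fun_eq_iff)
    then show ?case using assms(2) by (simp only: wprod.simps)
  next
    case (Cons x xs)
    then have "\<rho> (wprod (x # xs)) = (\<lambda>v. refl (\<beta> x) (\<rho> (wprod xs) v))"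
      by (simp add: fun_eq_iff rep_mult rep_gen gen_closed)
    then show ?case using assms(3) Cons by simp
  qed
  then show ?thesis using xs by simp
qed

lemma rep_add: "w \<in> carrier G \<Longrightarrow> \<rho> w (u + v) = \<rho> w u + \<rho> w v"
  by (rule rep_wprod_induct) (simp_all add: refl_add)

lemma rep_scale: "w \<in> carrier G \<Longrightarrow> \<rho> w (r *\<^sub>R u) = r *\<^sub>R \<rho> w u"
  by (rule rep_wprod_induct) (simp_all add: refl_scale)

lemma rep_minus: "w \<in> carrier G \<Longrightarrow> \<rho> w (- u) = - \<rho> w u"
  using rep_scale[of w "-1" u] by simp

lemma rep_diff: "w \<in> carrier G \<Longrightarrow> \<rho> w (u - v) = \<rho> w u - \<rho> w v"
  using rep_add[of w u "- v"] by (simp add: rep_minus)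

lemma rep_isometry: "w \<in> carrier G \<Longrightarrow> B (\<rho> w u) (\<rho> w v) = B u v"
  by (rule rep_wprod_induct) (simp_all add: refl_isometry root_norm)

lemma rep_inv: "w \<in> carrier G \<Longrightarrow> \<rho> (inv w) (\<rho> w v) = v"
  by (simp add: rep_one flip: rep_mult)

lemma rep_inv': "w \<in> carrier G \<Longrightarrow> \<rho> w (\<rho> (inv w) v) = v"
  by (simp add: rep_one flip: rep_mult)

lemma rep_conj_gen:
  assumes "w \<in> carrier G" "x \<in> X"
  shows "\<rho> (w \<otimes> g x \<otimes> inv w) v = refl (\<rho> w (\<beta> x)) v"
proof -
  have "B (\<rho> (inv w) v) (\<beta> x) = B v (\<rho> w (\<beta> x))"
    using rep_isometry[OF assms(1), of "\<rho> (inv w) v" "\<beta> x"] assms by (simp add: rep_inv')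
  then show ?thesis
    using assms by (simp add: rep_mult gen_closed rep_gen refl_def rep_diff rep_scale rep_inv')
qed

section \<open>Alternating words and braid relations\<close>

fun alt :: "'x \<Rightarrow> 'x \<Rightarrow> nat \<Rightarrow> 'x list" where
  "alt x y 0 = []"
| "alt x y (Suc k) = alt y x k @ [y]"

lemma length_alt [simp]: "length (alt x y k) = k"
  by (induction x y k rule: alt.induct) simp_all

lemma set_alt: "set (alt x y k) \<subseteq> {x, y}"
  by (induction x y k rule: alt.induct) auto

lemma set_alt_subset [simp]: "\<lbrakk>x \<in> X; y \<in> X\<rbrakk> \<Longrightarrow> set (alt x y k) \<subseteq> X"
  using set_alt[of x y k] by auto

lemma alt_add: "alt x y (j + k) = (if even k then alt x y j else alt y x j) @ alt x y k"
  by (induction k arbitrary: x y) simp_all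

lemma alt_Suc_left: "alt x y (Suc k) = (if even k then y else x) # alt x y k"
  using alt_add[of x y 1 k] by simp

lemma rev_alt: "rev (alt x y k) = (if even k then alt y x k else alt x y k)"
proof (induction k)
  case (Suc k)
  then show ?case by (subst alt_Suc_left) simp
qed simp

lemma rep_alt:
  "\<lbrakk>x \<in> X; y \<in> X\<rbrakk> \<Longrightarrow> \<rho> (wprod (alt x y k)) v = altr (\<beta> x) (\<beta> y) k v"
  by (induction k arbitrary: x y v) (simp_all add: rep_one wprod_append gen_closed rep_mult rep_gen)

lemma wprod_alt_even:
  "\<lbrakk>x \<in> X; y \<in> X\<rbrakk> \<Longrightarrow> wprod (alt x y (2 * k)) = (g x \<otimes> g y) [^] k"
proof (induction k)
  case (Suc k)
  have "alt x y (2 * Suc k) = alt x y (2 * k) @ [x, y]" by simp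
  then show ?case using Suc by (simp add: wprod_append gen_closed m_assoc)
qed simp

text \<open>An alternating word of length 2 m is trivial and splits into two halves; the inverse of
  the left half, its reversal, is the other alternating word.\<close>

lemma braid:
  assumes "x \<in> X" "y \<in> X" "(g x \<otimes> g y) [^] m = \<one>"
  shows "wprod (alt x y m) = wprod (alt y x m)"
proof -
  let ?P = "if even m then alt x y m else alt y x m"
  have P: "set ?P \<subseteq> X" using assms by simp
  have "wprod ?P \<otimes> wprod (alt x y m) = wprod (alt x y (2 * m))"
    using assms P by (simp add: mult_2 alt_add wprod_append)
  also have "\<dots> = \<one>" using assms wprod_alt_even by simp
  finally have "wprod (alt x y m) = inv (wprod ?P)"
    using P assms by (metis inv_equality inv_inv set_alt_subset wprod_closed inv_closed)
  also have "\<dots> = wprod (rev ?P)" using P by (simp only: wprod_rev)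
  also have "rev ?P = alt y x m" by (simp add: rev_alt)
  finally show ?thesis .
qed

text \<open>Reduction to the dihedral group of \<open>x\<close> and a descent \<open>y\<close> of
  \<open>w\<close>. For \<open>w = v u\<close> as below, induction puts the images of both roots
  under \<open>v\<close> in the cone, and \<open>\<rho> w (\<beta> x)\<close> combines them with
  nonnegative Chebyshev coefficients. The hypothesis is the exact negation of a descent, so
  \<open>root_negative\<close> covers the other case.\<close>

theorem root_positive:
  assumes "w \<in> carrier G" "x \<in> X" "len w \<le> len (w \<otimes> g x)"
  shows "\<rho> w (\<beta> x) \<in> K"
  using assms
proof (induction "len w" arbitrary: w x rule: less_induct)
  case less
  note w = less.prems(1) and x = less.prems(2) and asc = less.prems(3)
  show ?case
  proof (cases "w = \<one>")
    case True
    then show ?thesis using x by (simp add: rep_one cone_root)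
  next
    case False
    then obtain y where y: "y \<in> X" "len (w \<otimes> g y) < len w" using ex_descent w by blast
    \<comment> \<open>Choose \<open>w = v u\<close> with \<open>u\<close> an alternating word in \<open>x, y\<close>, lengths adding up, and \<open>v\<close> as short as
      possible; then \<open>v\<close> has neither \<open>x\<close> nor \<open>y\<close> as a descent.\<close>
    define P where "P v k p q \<longleftrightarrow> v \<in> carrier G \<and> (p = x \<and> q = y \<or> p = y \<and> q = x) \<and>
      w = v \<otimes> wprod (alt p q k) \<and> len w = len v + k" for v k p q
    have "len w \<le> Suc (len (w \<otimes> g y))"
      using len_mult_wprod[of "w \<otimes> g y" "[y]"] w y by (simp add: gen_closed)
    then have P0: "P (w \<otimes> g y) 1 x y"
      using w y by (simp add: P_def gen_closed)
    then obtain v where "\<exists>k p q. P v k p q" and min: "\<And>v'. \<exists>k p q. P v' k p q \<Longrightarrow> len v \<le> len v'"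
      using ex_has_least_nat[of "\<lambda>v. \<exists>k p q. P v k p q" _ len] by blast
    then obtain k p q where P: "P v k p q" by blast
    have v: "v \<in> carrier G" using P by (simp add: P_def)
    have "len v \<le> len (w \<otimes> g y)" using P0 by (intro min) blast
    then have lenv: "len v < len w" using y by simp
    then obtain k' where k: "k = Suc k'" using P by (cases k) (auto simp: P_def)
    have pq: "p \<in> X" "q \<in> X" using P x y by (auto simp: P_def)
    \<comment> \<open>A word ending in \<open>x\<close> would lose a letter on multiplication by
      \<open>g x\<close>, against the assumption on \<open>w\<close>.\<close>
    have "q \<noteq> x"
    proof
      assume "q = x"
      then have "w \<otimes> g x = v \<otimes> wprod (alt q p k')"
        using P v pq x by (simp add: P_def k wprod_append gen_closed m_assoc gen_square)
      then have "len (w \<otimes> g x) \<le> len v + k'"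
        using len_mult_wprod[of v "alt q p k'"] v pq by simp
      then show False using asc P by (simp add: P_def k)
    qed
    then have wv: "w = v \<otimes> wprod (alt x y k)" and lenw: "len w = len v + k"
      using P by (auto simp: P_def)
    have "len v \<le> len (v \<otimes> g z)" if z: "z \<in> {x, y}" for z
    proof (rule ccontr)
      assume "\<not> len v \<le> len (v \<otimes> g z)"
      then have less: "len (v \<otimes> g z) < len v" by simp
      have zX: "z \<in> X" using z x y by auto
      have vz: "v \<otimes> g z \<in> carrier G" using v zX by (simp add: gen_closed)
      have wz: "w = v \<otimes> g z \<otimes> (g z \<otimes> wprod (alt x y k))"
        unfolding wv using v zX x y by (simp add: gen_closed gen_square flip: m_assoc)
      show False
      \<comment> \<open>Either \<open>z\<close> cancels the first letter of the alternating word,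
        and \<open>w\<close> becomes too short, or it prolongs the word, and \<open>v\<close> was
        not minimal.\<close>
      proof (cases "z = (if even k' then y else x)")
        case True
        then have "g z \<otimes> wprod (alt x y k) = wprod (alt x y k')"
          unfolding k alt_Suc_left using zX x y
          by (simp add: gen_closed gen_square flip: m_assoc)
        then have "len w \<le> len (v \<otimes> g z) + k'"
          using wz len_mult_wprod[OF vz, of "alt x y k'"] x y by simp
        then show False using less lenw k by simp
      next
        case False
        then have "z = (if even k then y else x)" using z k by auto
        then have "g z \<otimes> wprod (alt x y k) = wprod (alt x y (Suc k))"
          unfolding alt_Suc_left by simp
        then have wz': "w = v \<otimes> g z \<otimes> wprod (alt x y (Suc k))" using wz by simp
        then have "len w \<le> len (v \<otimes> g z) + Suc k"
          using len_mult_wprod[OF vz, of "alt x y (Suc k)"] x y by simp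
        then have "P (v \<otimes> g z) (Suc k) x y"
          using wz' vz less lenw unfolding P_def by simp
        then have "len v \<le> len (v \<otimes> g z)" by (intro min) blast
        then show False using less by simp
      qed
    qed
    then have K: "\<rho> v (\<beta> x) \<in> K" "\<rho> v (\<beta> y) \<in> K"
      using less.hyps[OF lenv v x] less.hyps[OF lenv v y(1)] by auto
    define b where "b = - B (\<beta> x) (\<beta> y)"
    have "0 \<le> cheb b k \<and> 0 \<le> cheb b (Suc k)"
      using pair_cases[OF x y(1)]
    proof (elim disjE exE conjE)
      assume "g x = g y"
      then show ?thesis using asc y by simp
    next
      fix m :: nat
      assume m: "2 \<le> m" "(g x \<otimes> g y) [^] m = \<one>" "B (\<beta> x) (\<beta> y) = - cos (pi / real m)"
      \<comment> \<open>If \<open>m \<le> k\<close>, the braid relation applied to the last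
        \<open>m\<close> letters would make the word end in \<open>x\<close>.\<close>
      have "k < m"
      proof (rule ccontr)
        assume "\<not> k < m"
        then obtain j where j: "k = j + m" by (metis add.commute le_Suc_ex not_le)
        obtain m' where m': "m = Suc m'" using m(1) by (cases m) auto
        define A where "A = (if even m then alt x y j else alt y x j)"
        have A: "set A \<subseteq> X" "length A = j" using x y by (simp_all add: A_def)
        have "wprod (alt x y k) = wprod A \<otimes> wprod (alt y x m)"
          using A x y by (simp add: j alt_add wprod_append braid[OF x y(1) m(2)] flip: A_def)
        then have "w = v \<otimes> wprod (A @ alt x y m') \<otimes> g x"
          using A v x y by (simp add: wv m' wprod_append gen_closed m_assoc)
        then have "w \<otimes> g x = v \<otimes> wprod (A @ alt x y m')"
          using v x y A by simp
        then have "len (w \<otimes> g x) \<le> len v + (j + m')"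
          using len_mult_wprod[OF v, of "A @ alt x y m'"] A x y by simp
        then show False using asc lenw j m' by simp
      qed
      then show ?thesis using m cheb_cos_pi_nonneg[of m] by (simp add: b_def)
    next
      assume "B (\<beta> x) (\<beta> y) \<le> -1"
      then show ?thesis using cheb_mono[of b] by (simp add: b_def)
    qed
    moreover have "\<rho> w (\<beta> x) = \<rho> v (altr (\<beta> x) (\<beta> y) k (\<beta> x))"
      using v x y by (simp add: wv rep_mult rep_alt)
    moreover have "B (\<beta> x) (\<beta> y) = - b" by (simp add: b_def)
    ultimately show ?thesis
      using K v root_norm[OF x] root_norm[OF y(1)]
      by (auto simp: altr_first rep_add rep_scale intro!: cone_add cone_scale)
  qed
qed

lemma root_descent:
  "\<lbrakk>w \<in> carrier G; x \<in> X; \<rho> w (\<beta> x) \<notin> K\<rbrakk> \<Longrightarrow> len (w \<otimes> g x) < len w"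
  using root_positive by force

lemma rep_mult_gen_root: "\<lbrakk>w \<in> carrier G; x \<in> X\<rbrakk> \<Longrightarrow> \<rho> (w \<otimes> g x) (\<beta> x) = - \<rho> w (\<beta> x)"
  by (simp add: rep_mult gen_closed rep_gen refl_self root_norm rep_minus)

lemma root_negative:
  assumes "w \<in> carrier G" "x \<in> X" "len (w \<otimes> g x) < len w"
  shows "- \<rho> w (\<beta> x) \<in> K"
  using root_positive[of "w \<otimes> g x" x] assms by (simp add: gen_closed rep_mult_gen_root)

lemma root_sign: "\<lbrakk>w \<in> carrier G; x \<in> X\<rbrakk> \<Longrightarrow> \<rho> w (\<beta> x) \<in> K \<or> - \<rho> w (\<beta> x) \<in> K"
  using root_positive root_negative by force

text \<open>A nontrivial \<open>w\<close> has a descent \<open>y\<close>; then the negative of the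
  fixed root \<beta> y lies in the cone as well, which is pointed.\<close>

theorem faithful:
  assumes "w \<in> carrier G" "\<And>x. x \<in> X \<Longrightarrow> \<rho> w (\<beta> x) = \<beta> x"
  shows "w = \<one>"
proof (rule ccontr)
  assume "w \<noteq> \<one>"
  then obtain y where y: "y \<in> X" "len (w \<otimes> g y) < len w" using ex_descent assms(1) by blast
  then have "- \<beta> y \<in> K" using root_negative assms by fastforce
  then have "\<beta> y = 0" using cone_root cone_pointed y by blast
  then show False using root_norm[OF y(1)] scale_left[of 0 0 0] by simp
qed

corollary faithful_eq:
  assumes "u \<in> carrier G" "w \<in> carrier G" "\<And>v. \<rho> u v = \<rho> w v"
  shows "u = w"
proof -
  have "inv w \<otimes> u = \<one>"
    using assms by (intro faithful) (simp_all add: rep_mult rep_inv)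
  then show ?thesis using assms by (metis inv_closed inv_equality inv_inv)
qed

end

section \<open>The geometric representation of a Coxeter group\<close>

definition word_val :: "('a, 'm) monoid_scheme \<Rightarrow> ('x \<Rightarrow> 'a) \<Rightarrow> 'x word \<Rightarrow> 'a" where
  "word_val G f w = foldr (\<lambda>(x, b) u. (if b then f x else inv\<^bsub>G\<^esub> f x) \<otimes>\<^bsub>G\<^esub> u) w \<one>\<^bsub>G\<^esub>"

context group
begin

lemma word_val_simps [simp]:
  "word_val G f [] = \<one>"
  "word_val G f ((x, b) # w) = (if b then f x else inv f x) \<otimes> word_val G f w"
  by (simp_all add: word_val_def)

lemma word_val_closed: "\<lbrakk>f \<in> X \<rightarrow> carrier G; w \<in> words X\<rbrakk> \<Longrightarrow> word_val G f w \<in> carrier G"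
  by (induction w) (auto dest: funcset_mem)

lemma word_val_append:
  "\<lbrakk>f \<in> X \<rightarrow> carrier G; u \<in> words X; v \<in> words X\<rbrakk> \<Longrightarrow>
    word_val G f (u @ v) = word_val G f u \<otimes> word_val G f v"
proof (induction u)
  case (Cons p u)
  obtain x b where p: "p = (x, b)" by (cases p)
  with Cons.prems have x: "f x \<in> carrier G" by auto
  have uv: "word_val G f u \<in> carrier G" "word_val G f v \<in> carrier G"
    using Cons.prems word_val_closed[of f X] by auto
  then show ?case using Cons x p by (simp add: m_assoc)
qed (simp add: word_val_closed)

lemma word_val_word_pow:
  assumes "f \<in> X \<rightarrow> carrier G" "w \<in> words X"
  shows "word_val G f (word_pow w k) = word_val G f w [^] k" "word_pow w k \<in> words X"
proof -
  have "word_val G f (word_pow w k) = word_val G f w [^] k \<and> word_pow w k \<in> words X"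
  proof (induction k)
    case (Suc k)
    have "word_pow w (Suc k) = w @ word_pow w k" by (simp add: word_pow_def)
    then show ?case
      using Suc assms word_val_closed[OF assms] by (simp add: word_val_append[of f X] flip: nat_pow_Suc2)
  qed (simp add: word_pow_def)
  then show "word_val G f (word_pow w k) = word_val G f w [^] k" "word_pow w k \<in> words X" by auto
qed

lemma word_val_equiv:
  assumes "word_equiv X R u v" "f \<in> X \<rightarrow> carrier G" "\<And>r. r \<in> R \<Longrightarrow> word_val G f r = \<one>"
  shows "word_val G f u = word_val G f v"
  using assms(1)
proof (induction rule: word_equiv.induct)
  case (word_equiv_cancel u v x b)
  then have "f x \<in> carrier G" using assms(2) by auto
  then have "word_val G f [(x, b), (x, \<not> b)] = \<one>" by simp
  moreover have "[(x, b), (x, \<not> b)] \<in> words X" using word_equiv_cancel by simp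
  ultimately show ?case
    using word_equiv_cancel assms(2) word_val_closed[OF assms(2)]
    by (simp add: word_val_append[OF assms(2)] del: word_val_simps append_Cons append_Nil)
next
  case (word_equiv_relator u v r)
  then show ?case
    using assms word_val_closed[OF assms(2)] by (simp add: word_val_append[OF assms(2)])
qed simp_all

lemma presented_group_hom:
  assumes "f \<in> X \<rightarrow> carrier G" "\<And>r. r \<in> R \<Longrightarrow> word_val G f r = \<one>"
  obtains h where "h \<in> hom (presented_group X R) G"
    "\<And>w. w \<in> words X \<Longrightarrow> h (word_class X R w) = word_val G f w"
proof
  define h where "h A = word_val G f (SOME w. w \<in> A)" for A
  show h: "h (word_class X R w) = word_val G f w" if w: "w \<in> words X" for w
  proof -
    have "w \<in> word_class X R w"
      using w by (simp add: word_class_def word_rel_def word_equiv_refl)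
    then have "(SOME w'. w' \<in> word_class X R w) \<in> word_class X R w" by (rule someI)
    then have "word_equiv X R w (SOME w'. w' \<in> word_class X R w)"
      by (simp add: word_class_def word_rel_def)
    then show ?thesis
      unfolding h_def using word_val_equiv[OF _ assms] by simp
  qed
  show "h \<in> hom (presented_group X R) G"
    by (rule homI) (auto simp: carrier_presented_group h mult_word_class word_val_append[OF assms(1)]
        word_val_closed[OF assms(1)])
qed

end

text \<open>The universal property moved along the isomorphism with the presented group. It creates
  the geometric representation out of the relations between the reflections.\<close>

lemma has_presentation_hom:
  fixes G :: "('a, 'm) monoid_scheme" and H :: "('b, 'k) monoid_scheme"
  assumes "has_presentation G X \<phi> R" "group H" "f \<in> X \<rightarrow> carrier H"
    "\<And>r. r \<in> R \<Longrightarrow> word_val H f r = \<one>\<^bsub>H\<^esub>"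
  obtains k where "k \<in> hom G H" "\<And>x. x \<in> X \<Longrightarrow> k (\<phi> x) = f x"
proof -
  interpret H: group H by fact
  interpret P: group "presented_group X R" by (rule group_presented_group)
  obtain h where h: "h \<in> iso (presented_group X R) G" "\<And>x. x \<in> X \<Longrightarrow> h (word_class X R [gen x]) = \<phi> x"
    using assms(1) by (auto simp: has_presentation_def)
  obtain k where k: "k \<in> hom (presented_group X R) H"
    "\<And>w. w \<in> words X \<Longrightarrow> k (word_class X R w) = word_val H f w"
    using H.presented_group_hom[OF assms(3,4)] by blast
  have inv: "inv_into (carrier (presented_group X R)) h \<in> hom G (presented_group X R)"
    using P.iso_set_sym[OF h(1)] by (simp add: iso_def)
  show thesis
  proof
    show "k \<circ> inv_into (carrier (presented_group X R)) h \<in> hom G H"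
      using hom_compose[OF inv k(1)] .
    fix x assume x: "x \<in> X"
    have inj: "inj_on h (carrier (presented_group X R))"
      using h(1) by (simp add: iso_def bij_betw_def)
    have "word_class X R [gen x] \<in> carrier (presented_group X R)"
      using x by (simp add: carrier_presented_group)
    then have "inv_into (carrier (presented_group X R)) h (\<phi> x) = word_class X R [gen x]"
      using h(2)[OF x] inv_into_f_f[OF inj] by metis
    moreover have "f x \<in> carrier H" using x assms(3) by auto
    ultimately show "(k \<circ> inv_into (carrier (presented_group X R)) h) (\<phi> x) = f x"
      using k(2)[of "[gen x]"] x by simp
  qed
qed

definition bij_group :: "('v \<Rightarrow> 'v) monoid" where
  "bij_group = \<lparr>carrier = {f. bij f}, monoid.mult = (\<circ>), one = id\<rparr>"

lemma bij_group_simps [simp]: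
  "carrier bij_group = {f. bij f}" "f \<otimes>\<^bsub>bij_group\<^esub> h = f \<circ> h" "\<one>\<^bsub>bij_group\<^esub> = id"
  by (simp_all add: bij_group_def)

lemma group_bij_group: "group bij_group"
proof (rule groupI)
  fix f :: "'v \<Rightarrow> 'v" assume "f \<in> carrier bij_group"
  then show "\<exists>h\<in>carrier bij_group. h \<otimes>\<^bsub>bij_group\<^esub> f = \<one>\<^bsub>bij_group\<^esub>"
    by (intro bexI[of _ "inv_into UNIV f"]) (auto simp: bij_imp_bij_inv bij_is_inj)
qed (auto intro: bij_comp simp: o_assoc)

section \<open>The Coxeter form and its reflections\<close>

definition simple_root :: "'g \<Rightarrow> 'g \<Rightarrow> real" where
  "simple_root s = (\<lambda>x. if x = s then 1 else 0)"

definition coxeter_form :: "('g, 'm) monoid_scheme \<Rightarrow> 'g set \<Rightarrow> ('g \<Rightarrow> real) \<Rightarrow> ('g \<Rightarrow> real) \<Rightarrow> real" where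
  "coxeter_form W S u v = (\<Sum>x\<in>S. \<Sum>y\<in>S. u x * v y * - cos (pi / real (coxeter_label W x y)))"

text \<open>The label \<open>\<infinity>\<close> is encoded as \<open>0\<close>, and then \<open>- cos (pi / 0) = -1\<close> is the usual entry of the
  Coxeter form.\<close>

lemma coxeter_form_simple_root:
  assumes "finite S" "s \<in> S"
  shows "coxeter_form W S u (simple_root s) = (\<Sum>x\<in>S. u x * - cos (pi / real (coxeter_label W x s)))"
proof -
  have "(\<Sum>y\<in>S. u x * simple_root s y * - cos (pi / real (coxeter_label W x y))) =
      (\<Sum>y\<in>S. if s = y then u x * - cos (pi / real (coxeter_label W x s)) else 0)" for x
    by (rule sum.cong) (auto simp: simple_root_def)
  then show ?thesis using assms by (simp add: coxeter_form_def)
qed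

lemma coxeter_form_simple_roots:
  assumes "finite S" "s \<in> S" "t \<in> S"
  shows "coxeter_form W S (simple_root s) (simple_root t) = - cos (pi / real (coxeter_label W s t))"
proof -
  have "coxeter_form W S (simple_root s) (simple_root t) =
      (\<Sum>x\<in>S. if s = x then - cos (pi / real (coxeter_label W s t)) else 0)"
    unfolding coxeter_form_simple_root[OF assms(1,3)]
    by (rule sum.cong) (auto simp: simple_root_def)
  then show ?thesis using assms by simp
qed

lemma coxeter_form_expand:
  assumes "finite S"
  shows "coxeter_form W S u v = (\<Sum>y\<in>S. v y * coxeter_form W S u (simple_root y))"
  unfolding coxeter_form_def[of W S u v]
  by (subst sum.swap) (simp add: coxeter_form_simple_root[OF assms] sum_distrib_left algebra_simps)

lemma coxeter_label_sym:
  assumes "coxeter_system W S" "s \<in> S" "t \<in> S"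
  shows "coxeter_label W s t = coxeter_label W t s"
proof -
  interpret group W using assms by (simp add: coxeter_system_def)
  have st: "s \<in> carrier W" "t \<in> carrier W" using assms by (auto simp: coxeter_system_def)
  have "inv\<^bsub>W\<^esub> u = u" if "u \<in> S" for u
  proof -
    have "u \<in> carrier W" "u [^]\<^bsub>W\<^esub> (2::nat) = \<one>\<^bsub>W\<^esub>"
      using that assms pow_ord_eq_1[of u] by (auto simp: coxeter_system_def)
    then show ?thesis by (intro inv_equality) (simp_all add: numeral_2_eq_2)
  qed
  then have "inv\<^bsub>W\<^esub> (s \<otimes>\<^bsub>W\<^esub> t) = t \<otimes>\<^bsub>W\<^esub> s" using assms st by (simp add: inv_mult_group)
  then show ?thesis using ord_inv[of "s \<otimes>\<^bsub>W\<^esub> t"] st by (simp add: coxeter_label_def)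
qed

lemma symmetric_form_coxeter_form:
  assumes "coxeter_system W S"
  shows "symmetric_form (coxeter_form W S)"
proof
  fix u v w :: "'a \<Rightarrow> real" and r :: real
  show "coxeter_form W S u v = coxeter_form W S v u"
    unfolding coxeter_form_def
    by (subst sum.swap) (auto intro!: sum.cong simp: coxeter_label_sym[OF assms])
  show "coxeter_form W S (u + v) w = coxeter_form W S u w + coxeter_form W S v w"
    by (simp add: coxeter_form_def distrib_right sum.distrib sum_negf sum_subtractf)
  show "coxeter_form W S (r *\<^sub>R u) w = r * coxeter_form W S u w"
    by (simp add: coxeter_form_def algebra_simps sum_distrib_left)
qed

lemma (in symmetric_form) refl_pow:
  "((refl \<alpha> \<circ> refl \<beta>) [^]\<^bsub>bij_group\<^esub> (k::nat)) v = altr \<alpha> \<beta> (2 * k) v"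
proof (induction k arbitrary: v)
  case (Suc k)
  then show ?case by (simp add: nat_pow_def)
qed (simp add: nat_pow_def)

text \<open>The reflections in the simple roots satisfy the Coxeter relators by
  \<open>altr_period\<close>, so the presentation yields the action.\<close>

theorem coxeter_reflection_group:
  assumes cs: "coxeter_system W S" and fin: "finite S"
  obtains \<rho> where "reflection_group (coxeter_form W S) W S (\<lambda>s. s) simple_root \<rho> {v. \<forall>x. 0 \<le> v x}"
proof -
  interpret group W using cs by (simp add: coxeter_system_def)
  interpret form: symmetric_form "coxeter_form W S" by (rule symmetric_form_coxeter_form[OF cs])
  interpret bij: group "bij_group :: (('a \<Rightarrow> real) \<Rightarrow> _) monoid" by (rule group_bij_group)
  have S: "s \<in> carrier W" "s [^]\<^bsub>W\<^esub> (2::nat) = \<one>\<^bsub>W\<^esub>" if "s \<in> S" for s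
    using that cs pow_ord_eq_1[of s] by (auto simp: coxeter_system_def)
  then have sq: "s \<otimes>\<^bsub>W\<^esub> s = \<one>\<^bsub>W\<^esub>" if "s \<in> S" for s
    using that by (simp add: numeral_2_eq_2)
  have "coxeter_label W s s = 1" if "s \<in> S" for s
    using sq[OF that] ord_eq_1 by (simp add: coxeter_label_def)
  then have norm: "coxeter_form W S (simple_root s) (simple_root s) = 1" if "s \<in> S" for s
    using that fin by (simp add: coxeter_form_simple_roots)
  \<comment> \<open>Label 1 forces \<open>s = t\<close>, the generators being involutions.\<close>
  have label: "coxeter_label W s t = 0 \<or> s = t \<or> 2 \<le> coxeter_label W s t" if "s \<in> S" "t \<in> S" for s t
  proof -
    have "s = t" if "coxeter_label W s t = 1"
    proof -
      have "s \<otimes>\<^bsub>W\<^esub> t = \<one>\<^bsub>W\<^esub>"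
        using that S[OF \<open>s \<in> S\<close>] S[OF \<open>t \<in> S\<close>] ord_eq_1 by (simp add: coxeter_label_def)
      then show ?thesis using S sq \<open>s \<in> S\<close> \<open>t \<in> S\<close> by (metis Units_l_cancel Units_eq)
    qed
    then show ?thesis by linarith
  qed
  let ?r = "\<lambda>s. form.refl (simple_root s)"
  have bij: "bij (?r s)" if "s \<in> S" for s
    by (rule o_bij[of "?r s"]) (simp_all add: o_def id_def norm that)
  have "word_val bij_group ?r r = \<one>\<^bsub>bij_group\<^esub>" if rel: "r \<in> coxeter_relators W S" for r
  proof -
    obtain s t where r: "r = word_pow [gen s, gen t] (coxeter_label W s t)" "s \<in> S" "t \<in> S" "coxeter_label W s t \<noteq> 0"
      using rel unfolding coxeter_relators_def by blast
    have "word_val bij_group ?r r = (?r s \<circ> ?r t) [^]\<^bsub>bij_group\<^esub> coxeter_label W s t"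
      unfolding r(1) using r bij by (subst bij.word_val_word_pow[where X = S]) auto
    also have "\<dots> = id"
    proof
      fix v
      show "((?r s \<circ> ?r t) [^]\<^bsub>bij_group\<^esub> coxeter_label W s t) v = id v"
      proof (cases "s = t")
        case True
        then have "coxeter_label W s t = 1" using sq[OF r(2)] ord_eq_1 by (simp add: coxeter_label_def)
        then show ?thesis using True norm[OF r(2)] by (simp add: nat_pow_def)
      next
        case False
        then show ?thesis
          using label[OF r(2,3)] r norm fin
          by (simp add: form.refl_pow form.altr_period coxeter_form_simple_roots)
      qed
    qed
    finally show ?thesis by simp
  qed
  then obtain \<rho> where \<rho>: "\<rho> \<in> hom W bij_group" "\<And>s. s \<in> S \<Longrightarrow> \<rho> s = ?r s"
    using has_presentation_hom[of W S "\<lambda>s. s" "coxeter_relators W S" bij_group ?r] cs bij group_bij_group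
    by (auto simp: coxeter_system_def)
  have "reflection_group (coxeter_form W S) W S (\<lambda>s. s) simple_root \<rho> {v. \<forall>x. 0 \<le> v x}"
  proof
    show "generate W ((\<lambda>s. s) ` S) = carrier W" using cs by (simp add: coxeter_system_def)
    show "\<rho> \<one>\<^bsub>W\<^esub> v = v" for v
      using hom_one[OF \<rho>(1)] group_axioms bij.group_axioms by simp
    show "\<rho> (u \<otimes>\<^bsub>W\<^esub> w) v = \<rho> u (\<rho> w v)" if "u \<in> carrier W" "w \<in> carrier W" for u w v
      using hom_mult[OF \<rho>(1) that] by simp
    show "s = t \<and> simple_root s = simple_root t \<or>
        (\<exists>m\<ge>2. (s \<otimes>\<^bsub>W\<^esub> t) [^]\<^bsub>W\<^esub> (m::nat) = \<one>\<^bsub>W\<^esub> \<and>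
          coxeter_form W S (simple_root s) (simple_root t) = - cos (pi / real m)) \<or>
        coxeter_form W S (simple_root s) (simple_root t) \<le> - 1" if "s \<in> S" "t \<in> S" for s t
    proof -
      have "(s \<otimes>\<^bsub>W\<^esub> t) [^]\<^bsub>W\<^esub> coxeter_label W s t = \<one>\<^bsub>W\<^esub>"
        using S that by (simp add: coxeter_label_def pow_ord_eq_1)
      then show ?thesis
        using label[OF that] coxeter_form_simple_roots[OF fin that, of W] by auto
    qed
  next
    fix v :: "'a \<Rightarrow> real"
    assume "v \<in> {v. \<forall>x. 0 \<le> v x}" "- v \<in> {v. \<forall>x. 0 \<le> v x}"
    then show "v = 0" by (auto simp: fun_eq_iff intro: antisym)
  qed (use S sq norm \<rho>(2) in \<open>auto simp: simple_root_def\<close>)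
  then show thesis by (rule that)
qed

section \<open>Transport around a cycle of odd edges\<close>

text \<open>Vertices are indexed by the integers, the universal cover of the cycle;
  \<open>base\<close> is a chosen lift of the given generator.\<close>

locale odd_cycle = reflection_group "coxeter_form W S" W S "\<lambda>s. s" simple_root \<rho> "{v. \<forall>x. 0 \<le> v x}"
  for W :: "('g, 'm) monoid_scheme" (structure) and S :: "'g set"
    and \<rho> :: "'g \<Rightarrow> ('g \<Rightarrow> real) \<Rightarrow> 'g \<Rightarrow> real" +
  fixes n :: nat and a :: "int \<Rightarrow> 'g" and base :: int
  assumes coxeter: "coxeter_system W S"
    and n_gt: "3 < n"
    and diagram: "odd_cycle_diagram W S n a"
begin

abbreviation form :: "('g \<Rightarrow> real) \<Rightarrow> ('g \<Rightarrow> real) \<Rightarrow> real" where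
  "form \<equiv> coxeter_form W S"

abbreviation \<alpha> :: "int \<Rightarrow> 'g \<Rightarrow> real" where
  "\<alpha> i \<equiv> simple_root (a i)"

definition m :: "int \<Rightarrow> nat" where
  "m i = coxeter_label W (a i) (a (i + 1))"

definition c :: "int \<Rightarrow> real" where
  "c i = cos (pi / real (m i))"

lemma a_in [simp]: "a i \<in> S"
  using diagram by (auto simp: odd_cycle_diagram_def)

lemma a_closed [simp]: "a i \<in> carrier W"
  using gen_closed by simp

lemma a_square [simp]: "a i \<otimes> a i = \<one>"
  using gen_square by simp

lemma a_inv [simp]: "inv (a i) = a i"
  using gen_inverse by simp

lemma S_index: "s \<in> S \<Longrightarrow> \<exists>i. s = a i"
  using diagram by (auto simp: odd_cycle_diagram_def)

lemma a_eq_iff: "a i = a j \<longleftrightarrow> int n dvd i - j"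
  using diagram by (simp add: odd_cycle_diagram_def cong_iff_dvd_diff)

lemma edge_iff: "diagram_edge W S (a i) (a j) \<longleftrightarrow> int n dvd j - i - 1 \<or> int n dvd j - i + 1"
proof -
  have eq: "j - (i + 1) = j - i - 1" "j - (i - 1) = j - i + 1" by simp_all
  have "diagram_edge W S (a i) (a j) \<longleftrightarrow> int n dvd j - (i + 1) \<or> int n dvd j - (i - 1)"
    using diagram by (simp add: odd_cycle_diagram_def cong_iff_dvd_diff)
  then show ?thesis by (simp only: eq)
qed

lemma a_period [simp]: "a (i + int n) = a i"
  by (simp add: a_eq_iff)

lemma a_shift [simp]: "a (i + 2 - int n) = a (i + 2)"
  by (simp add: a_eq_iff)

lemma not_dvd: "\<lbrakk>0 < k; k < int n\<rbrakk> \<Longrightarrow> \<not> int n dvd k"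
  using zdvd_imp_le[of "int n" k] by auto

text \<open>The freedom in \<open>k\<close> lets later case distinctions measure the position of a
  generator relative to a given vertex.\<close>

lemma S_residue: "s \<in> S \<Longrightarrow> \<exists>j. k \<le> j \<and> j < k + int n \<and> s = a j"
proof -
  assume "s \<in> S"
  then obtain i where i: "s = a i" using S_index by blast
  define j where "j = k + (i - k) mod int n"
  have "int n dvd i - j" by (simp add: j_def dvd_minus_mod algebra_simps flip: diff_diff_eq)
  then show ?thesis
    using i n_gt by (intro exI[of _ j]) (auto simp: j_def a_eq_iff)
qed

lemma finite_S [simp]: "finite S"
proof -
  have "S \<subseteq> a ` {0..<int n}" using S_residue[of _ 0] by fastforce
  then show ?thesis by (rule finite_subset) simp
qed

lemma m_odd: "odd (m i)"
  using diagram by (simp add: m_def odd_cycle_diagram_def)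

lemma a_succ_neq: "a i \<noteq> a (i + 1)"
  using not_dvd[of 1] n_gt by (simp add: a_eq_iff dvd_diff_commute[of _ i])

lemma m_ge: "3 \<le> m i"
proof -
  have "m i \<noteq> 1"
  proof
    assume "m i = 1"
    then have "a i \<otimes> a (i + 1) = \<one>"
      using ord_eq_1[of "a i \<otimes> a (i + 1)"] by (simp add: m_def coxeter_label_def)
    then have "a (i + 1) = a i" by (metis a_closed a_square Units_l_cancel Units_eq)
    then show False using a_succ_neq[of i] by simp
  qed
  then show ?thesis using m_odd[of i] by (auto elim!: oddE)
qed

lemma m_period [simp]: "m (i + int n) = m i"
proof -
  have "a (i + int n + 1) = a (i + 1)" using a_period[of "i + 1"] by (simp add: algebra_simps)
  then show ?thesis by (simp add: m_def)
qed

lemma c_bounds: "1 / 2 \<le> c i" "c i < 1"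
proof -
  have "cos (pi / 3) \<le> cos (pi / real (m i))"
    using m_ge[of i] by (intro cos_monotone_0_pi_le) (auto simp: field_simps)
  then show "1 / 2 \<le> c i" by (simp add: c_def cos_60)
  show "c i < 1" using cos_pi_over_bounds[of "m i"] m_ge[of i] by (simp add: c_def)
qed

lemma label_sym: "coxeter_label W (a i) (a j) = coxeter_label W (a j) (a i)"
  using coxeter_label_sym[OF coxeter] by simp

lemma label_far: "\<lbrakk>2 \<le> j - i; j - i \<le> int n - 2\<rbrakk> \<Longrightarrow> coxeter_label W (a i) (a j) = 2"
proof -
  assume ij: "2 \<le> j - i" "j - i \<le> int n - 2"
  have "\<not> diagram_edge W S (a i) (a j)"
    using not_dvd[of "j - i - 1"] not_dvd[of "j - i + 1"] ij unfolding edge_iff by simp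
  moreover have "a i \<noteq> a j"
    using not_dvd[of "j - i"] ij by (simp add: a_eq_iff dvd_diff_commute[of _ i])
  ultimately show ?thesis by (simp add: diagram_edge_def)
qed

lemma form_self [simp]: "form (\<alpha> i) (\<alpha> i) = 1"
  using root_norm by simp

lemma form_succ [simp]: "form (\<alpha> i) (\<alpha> (i + 1)) = - c i" "form (\<alpha> (i + 1)) (\<alpha> i) = - c i"
  using label_sym by (simp_all add: coxeter_form_simple_roots c_def m_def)

lemma form_far:
  assumes "i + 2 \<le> j" "j \<le> i + int n - 2"
  shows "form (\<alpha> i) (\<alpha> j) = 0" "form (\<alpha> j) (\<alpha> i) = 0"
proof -
  have "coxeter_label W (a i) (a j) = 2" by (rule label_far; use assms in linarith)
  then show "form (\<alpha> i) (\<alpha> j) = 0" "form (\<alpha> j) (\<alpha> i) = 0"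
    using label_sym[of i j] by (simp_all add: coxeter_form_simple_roots)
qed

lemma commute_far:
  assumes "2 \<le> j - i" "j - i \<le> int n - 2"
  shows "a i \<otimes> a j = a j \<otimes> a i"
proof -
  have "(a i \<otimes> a j) [^] (2::nat) = \<one>"
    using label_far[OF assms] pow_ord_eq_1[of "a i \<otimes> a j"] by (simp add: coxeter_label_def)
  then have "a i \<otimes> a j = inv (a i \<otimes> a j)"
    by (intro inv_equality[symmetric]) (simp_all add: numeral_2_eq_2)
  then show ?thesis by (simp add: inv_mult_group)
qed

section \<open>Transport along edges and along lifted paths\<close>

definition e :: "int \<Rightarrow> 'g" where
  "e k = (a (k + 1) \<otimes> a k) [^] ((m k - 1) div 2)"

lemma e_closed [simp]: "e k \<in> carrier W"
  by (simp add: e_def)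

lemma half_m: "2 * ((m k - 1) div 2) + 1 = m k" "1 \<le> (m k - 1) div 2"
  using m_odd[of k] m_ge[of k] by (auto elim!: oddE)

lemma e_wprod: "e k = wprod (alt (a (k + 1)) (a k) (2 * ((m k - 1) div 2)))"
  by (simp add: e_def wprod_alt_even)

lemma e_rep: "\<rho> (e k) v = altr (\<alpha> (k + 1)) (\<alpha> k) (2 * ((m k - 1) div 2)) v"
  unfolding e_wprod by (rule rep_alt) simp_all

lemma e_root: "\<rho> (e k) (\<alpha> (k + 1)) = \<alpha> k"
  using altr_transport_root(1)[of "\<alpha> k" "\<alpha> (k + 1)" "(m k - 1) div 2", unfolded half_m(1)] half_m(2)[of k]
  by (simp add: e_rep c_def)

lemma e_transport:
  "form v (\<alpha> (k + 1)) = 0 \<Longrightarrow> \<rho> (e k) v = v - (form v (\<alpha> k) / (1 - c k)) *\<^sub>R (\<alpha> k + \<alpha> (k + 1))"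
  using altr_transport[of "\<alpha> k" "\<alpha> (k + 1)" "(m k - 1) div 2" v, unfolded half_m(1)] half_m(2)[of k]
  by (simp add: e_rep c_def)

text \<open>Both sides act as the reflection in \<open>\<alpha> k\<close>, and the geometric
  representation is faithful.\<close>

lemma e_conj: "e k \<otimes> a (k + 1) \<otimes> inv (e k) = a k"
  by (rule faithful_eq) (simp_all add: rep_conj_gen e_root rep_gen)

lemma pow_commute:
  assumes "x \<in> carrier W" "y \<in> carrier W" "x \<otimes> y = y \<otimes> x"
  shows "x [^] (k::nat) \<otimes> y = y \<otimes> x [^] k"
proof (induction k)
  case (Suc k)
  have "x [^] Suc k \<otimes> y = x [^] k \<otimes> y \<otimes> x" using assms by (simp add: m_assoc)
  then show ?case using Suc assms by (simp add: m_assoc)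
qed (simp add: assms)

text \<open>Under these bounds both generators of the edge from \<open>k\<close> to
  \<open>k + 1\<close> are distinct from and not adjacent to \<open>a j\<close>, so they commute
  with it.\<close>

lemma e_commute:
  assumes "2 \<le> k - j" "k + 1 - j \<le> int n - 2"
  shows "e k \<otimes> a j = a j \<otimes> e k"
proof -
  have comm: "a j \<otimes> a k = a k \<otimes> a j" "a j \<otimes> a (k + 1) = a (k + 1) \<otimes> a j"
    by (rule commute_far; use assms in linarith)+
  have "a (k + 1) \<otimes> a k \<otimes> a j = a (k + 1) \<otimes> a j \<otimes> a k"
    by (simp add: m_assoc comm)
  also have "\<dots> = a j \<otimes> a (k + 1) \<otimes> a k"
    by (simp add: comm)
  finally have "a (k + 1) \<otimes> a k \<otimes> a j = a j \<otimes> (a (k + 1) \<otimes> a k)" by (simp add: m_assoc)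
  then show ?thesis unfolding e_def by (rule pow_commute[rotated 2]) simp_all
qed

primrec q_up :: "nat \<Rightarrow> 'g" where
  "q_up 0 = \<one>"
| "q_up (Suc k) = q_up k \<otimes> e (base + int k)"

primrec q_down :: "nat \<Rightarrow> 'g" where
  "q_down 0 = \<one>"
| "q_down (Suc k) = q_down k \<otimes> inv (e (base - int k - 1))"

text \<open>The element \<open>p_\<gamma>\<close> of the straight path from \<open>base\<close> to
  \<open>k\<close> in the integers. The two recursions serve the two directions, and
  \<open>q_succ\<close> unites them.\<close>

definition q :: "int \<Rightarrow> 'g" where
  "q k = (if base \<le> k then q_up (nat (k - base)) else q_down (nat (base - k)))"

lemma q_base [simp]: "q base = \<one>"
  by (simp add: q_def)

lemma q_up_closed [simp]: "q_up k \<in> carrier W"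
  by (induction k) simp_all

lemma q_down_closed [simp]: "q_down k \<in> carrier W"
  by (induction k) simp_all

lemma q_closed [simp]: "q k \<in> carrier W"
  by (simp add: q_def)

lemma q_succ: "q (k + 1) = q k \<otimes> e k"
proof (cases "base \<le> k")
  case True
  then have "nat (k + 1 - base) = Suc (nat (k - base))" by simp
  then show ?thesis using True by (simp add: q_def)
next
  case False
  then have 1: "nat (base - k) = Suc (nat (base - (k + 1)))" by simp
  have 2: "base - int (nat (base - (k + 1))) - 1 = k" using False by simp
  have "q_down (nat (base - k)) = q_down (nat (base - (k + 1))) \<otimes> inv (e k)"
    unfolding 1 q_down.simps 2 ..
  moreover have "q (k + 1) = q_down (nat (base - (k + 1)))"
    using False by (cases "k + 1 = base") (simp_all add: q_def)
  ultimately show ?thesis using False by (simp add: q_def m_assoc)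
qed

lemma q_pred: "q (k - 1) = q k \<otimes> inv (e (k - 1))"
  using q_succ[of "k - 1"] by (simp add: m_assoc)

lemma e_eq_q: "e k = inv (q k) \<otimes> q (k + 1)"
  by (simp add: q_succ flip: m_assoc)

lemma e_period [simp]: "e (k + int n) = e k"
proof -
  have "a (k + int n + 1) = a (k + 1)" using a_period[of "k + 1"] by (simp add: algebra_simps)
  then show ?thesis by (simp add: e_def)
qed

definition loop :: 'g where
  "loop = q (base + int n)"

lemma loop_closed [simp]: "loop \<in> carrier W"
  by (simp add: loop_def)

text \<open>As \<open>e\<close> has period \<open>n\<close>, going around the cycle once before
  following a path only adds the left factor \<open>loop\<close>.\<close>

lemma q_period: "q (k + int n) = loop \<otimes> q k"
proof (induction k rule: int_induct[of _ base])
  case base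
  show ?case by (simp add: loop_def)
next
  case (step1 i)
  have "q (i + 1 + int n) = q (i + int n) \<otimes> e i"
    using q_succ[of "i + int n"] by (simp add: algebra_simps)
  then show ?case using step1 by (simp add: q_succ m_assoc)
next
  case (step2 i)
  have "e (i - 1 + int n) = e (i - 1)" by (rule e_period)
  then have "q (i - 1 + int n) = q (i + int n) \<otimes> inv (e (i - 1))"
    using q_pred[of "i + int n"] by (simp add: algebra_simps)
  then show ?case using step2 by (simp add: q_pred m_assoc)
qed

lemma q_root: "\<rho> (q k) (\<alpha> k) = \<alpha> base"
proof (induction k rule: int_induct[of _ base])
  case base
  show ?case by (simp add: rep_one)
next
  case (step1 i)
  then show ?case by (simp add: q_succ rep_mult e_root)
next
  case (step2 i)
  have "\<rho> (inv (e (i - 1))) (\<alpha> (i - 1)) = \<alpha> i"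
    using rep_inv[of "e (i - 1)" "\<alpha> i"] e_root[of "i - 1"] by simp
  then show ?case using step2 by (simp add: q_pred rep_mult)
qed

lemma q_conj: "q k \<otimes> a k \<otimes> inv (q k) = a base"
  by (rule faithful_eq) (simp_all add: rep_conj_gen q_root rep_gen)

definition \<sigma> :: "int \<Rightarrow> 'g" where
  "\<sigma> j = q (j + 2) \<otimes> a j \<otimes> inv (q (j + 2))"

definition \<beta> :: "int \<Rightarrow> 'g \<Rightarrow> real" where
  "\<beta> j = \<rho> (q (j + 2)) (\<alpha> j)"

lemma \<sigma>_closed [simp]: "\<sigma> j \<in> carrier W"
  by (simp add: \<sigma>_def)

lemma \<sigma>_rep: "\<rho> (\<sigma> j) v = refl (\<beta> j) v"
  by (simp add: \<sigma>_def \<beta>_def rep_conj_gen)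

lemma \<beta>_norm [simp]: "form (\<beta> j) (\<beta> j) = 1"
  by (simp add: \<beta>_def rep_isometry)

text \<open>For the edges inside this range \<open>e i\<close> commutes with \<open>a j\<close> and
  fixes \<open>\<alpha> j\<close>. The vertex \<open>j + 2\<close> in the definitions of \<sigma>
  and \<beta> is thus the first of n - 3 equivalent choices.\<close>

lemma \<sigma>_at_\<beta>_at:
  assumes "j + 2 \<le> k" "k \<le> j + int n - 2"
  shows "\<sigma> j = q k \<otimes> a j \<otimes> inv (q k) \<and> \<beta> j = \<rho> (q k) (\<alpha> j)"
  using assms
proof (induction k rule: int_ge_induct)
  case base
  then show ?case by (simp add: \<sigma>_def \<beta>_def)
next
  case (step i)
  have "e i \<otimes> a j \<otimes> inv (e i) = a j"
    using e_commute[of i j] step by (simp add: m_assoc)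
  moreover have "q (i + 1) \<otimes> a j \<otimes> inv (q (i + 1)) = q i \<otimes> (e i \<otimes> a j \<otimes> inv (e i)) \<otimes> inv (q i)"
    by (simp add: q_succ inv_mult_group m_assoc)
  moreover have "form (\<alpha> j) (\<alpha> i) = 0" "form (\<alpha> j) (\<alpha> (i + 1)) = 0"
    by (rule form_far(1); use step in linarith)+
  then have "\<rho> (e i) (\<alpha> j) = \<alpha> j"
    using e_transport[of "\<alpha> j" i] by simp
  ultimately show ?case using step by (simp add: rep_mult) (simp add: q_succ rep_mult)
qed

lemmas \<sigma>_at = \<sigma>_at_\<beta>_at[THEN conjunct1]
lemmas \<beta>_at = \<sigma>_at_\<beta>_at[THEN conjunct2]

lemma \<sigma>_period: "\<sigma> (j + int n) = loop \<otimes> \<sigma> j \<otimes> inv loop"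
proof -
  have "q (j + int n + 2) = loop \<otimes> q (j + 2)"
    using q_period[of "j + 2"] by (simp add: algebra_simps)
  then show ?thesis by (simp add: \<sigma>_def inv_mult_group m_assoc)
qed

text \<open>Conjugation by \<open>q (j + 2)\<close> takes the generators \<open>a j\<close> and
  \<open>a (j + 2)\<close>, which commute and differ because n > 3, to \<sigma> j and
  \<open>a base\<close>.\<close>

lemma \<sigma>_centralizes: "\<sigma> j \<in> reflections W S \<inter> centralizer W (a base) - {a base}"
proof -
  have far: "2 \<le> (j + 2) - j" "(j + 2) - j \<le> int n - 2" using n_gt by auto
  note comm = commute_far[OF far]
  have ne: "a j \<noteq> a (j + 2)"
    using not_dvd[of 2] n_gt by (simp add: a_eq_iff dvd_diff_commute[of _ j])
  let ?q = "q (j + 2)"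
  have conj: "?q \<otimes> x \<otimes> inv ?q \<otimes> (?q \<otimes> y \<otimes> inv ?q) = ?q \<otimes> (x \<otimes> y) \<otimes> inv ?q"
    if "x \<in> carrier W" "y \<in> carrier W" for x y
    using that by (simp add: m_assoc) (simp add: l_inv flip: m_assoc[of "inv ?q"])
  have "\<sigma> j \<otimes> a base = a base \<otimes> \<sigma> j"
    by (simp add: \<sigma>_def conj comm flip: q_conj[of "j + 2"])
  moreover have "\<sigma> j \<noteq> a base"
  proof
    assume "\<sigma> j = a base"
    then have "?q \<otimes> a j \<otimes> inv ?q = ?q \<otimes> a (j + 2) \<otimes> inv ?q" by (simp add: \<sigma>_def q_conj)
    then show False using ne by simp
  qed
  moreover have "\<sigma> j \<in> reflections W S"
    unfolding reflections_def \<sigma>_def using a_in q_closed by blast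
  ultimately show ?thesis by (simp add: centralizer_def)
qed

section \<open>Elements of closed paths and the generator of \<open>Gamma_Omega\<close>\<close>

lemma a_pred_e: "(a k \<otimes> a (k + 1)) [^] ((m k - 1) div 2) = inv (e k)"
  by (simp add: e_def inv_mult_group flip: nat_pow_inv)

text \<open>A path in the cycle lifts step by step to the integers, and its factors telescope, so
  only the two lifted ends matter.\<close>

lemma path_elt_q:
  assumes "odd_path W S ts" "hd ts = a k"
  shows "\<exists>k'. last ts = a k' \<and> path_elt W ts = inv (q k) \<otimes> q k'"
  using assms
proof (induction ts arbitrary: k)
  case (Cons t us)
  have t: "t = a k" using Cons.prems by simp
  show ?case
  proof (cases us)
    case Nil
    then show ?thesis using t by auto
  next
    case us: (Cons t' ts)
    have path: "odd_edge W S ((t # t' # ts) ! i) ((t # t' # ts) ! Suc i)" if "Suc i < length (t # t' # ts)" for i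
      using that Cons.prems(1) unfolding odd_path_def us by blast
    have edge: "odd_edge W S t t'" using path[of 0] by simp
    have rest: "odd_path W S (t' # ts)"
      using path[of "Suc i" for i] Cons.prems(1) us by (simp add: odd_path_def)
    note IH = Cons.IH[unfolded us, OF rest]
    obtain j where j: "t' = a j" using S_index edge by (auto simp: odd_edge_def)
    have "coxeter_label W t t' \<noteq> 2" using edge by (auto simp: odd_edge_def)
    then have "diagram_edge W S (a k) (a j)" using edge t j by (simp add: diagram_edge_def odd_edge_def)
    then consider "int n dvd j - (k + 1)" | "int n dvd j - (k - 1)" unfolding edge_iff by (auto simp: algebra_simps)
    then show ?thesis
    proof cases
      case 1
      then have t': "t' = a (k + 1)" by (simp add: j a_eq_iff)
      then obtain k' where k': "last (t' # ts) = a k'" "path_elt W (t' # ts) = inv (q (k + 1)) \<otimes> q k'"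
        using IH[of "k + 1"] by auto
      have "path_elt W (t # t' # ts) = e k \<otimes> (inv (q (k + 1)) \<otimes> q k')"
        using k' by (simp add: t t' e_def m_def)
      also have "\<dots> = inv (q k) \<otimes> q k'"
        unfolding e_eq_q by (simp add: m_assoc) (simp flip: m_assoc)
      finally show ?thesis using k' us by auto
    next
      case 2
      then have t': "t' = a (k - 1)" by (simp add: j a_eq_iff)
      then obtain k' where k': "last (t' # ts) = a k'" "path_elt W (t' # ts) = inv (q (k - 1)) \<otimes> q k'"
        using IH[of "k - 1"] by auto
      have "path_elt W (t # t' # ts) = inv (e (k - 1)) \<otimes> (inv (q (k - 1)) \<otimes> q k')"
        using k' a_pred_e[of "k - 1"] label_sym[of k "k - 1"] by (simp add: t t' m_def)
      also have "\<dots> = inv (q k) \<otimes> q k'"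
        unfolding e_eq_q by (simp add: inv_mult_group m_assoc) (simp flip: m_assoc)
      finally show ?thesis using k' us by auto
    qed
  qed
qed (simp add: odd_path_def)

lemma path_elt_segment: "path_elt W (map (\<lambda>i. a (k + int i)) [0..<Suc l]) = inv (q k) \<otimes> q (k + int l)"
proof (induction l arbitrary: k)
  case (Suc l)
  have 1: "map (\<lambda>i. a (k + int i)) [0..<Suc (Suc l)] = a k # map (\<lambda>i. a (k + 1 + int i)) [0..<Suc l]"
    by (simp add: upt_conv_Cons map_Suc_upt[symmetric] algebra_simps comp_def del: upt_Suc)
  also have 2: "\<dots> = a k # a (k + 1) # map (\<lambda>i. a (k + 1 + int i)) [1..<Suc l]"
    by (simp add: upt_conv_Cons del: upt_Suc)
  finally have "path_elt W (map (\<lambda>i. a (k + int i)) [0..<Suc (Suc l)]) =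
      e k \<otimes> path_elt W (map (\<lambda>i. a (k + 1 + int i)) [0..<Suc l])"
    using 2 by (simp add: e_def m_def)
  also have "\<dots> = inv (q k) \<otimes> q (k + 1) \<otimes> (inv (q (k + 1)) \<otimes> q (k + 1 + int l))"
    by (simp only: Suc e_eq_q)
  also have "\<dots> = inv (q k) \<otimes> q (k + 1 + int l)"
    by (simp add: m_assoc) (simp flip: m_assoc)
  finally show ?case by (simp add: algebra_simps)
qed simp

lemma odd_edge_succ: "odd_edge W S (a i) (a (i + 1))"
  using m_odd[of i] a_succ_neq[of i] by (simp add: odd_edge_def m_def)

lemma loop_pow_succ: "loop [^] (i + 1) = loop \<otimes> loop [^] (i::int)"
  using int_pow_mult[of loop 1 i] by (simp add: add.commute)

lemma loop_power: "q (base + int n * l) = loop [^] l" for l :: int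
proof (induction l rule: int_induct[of _ 0])
  case base
  show ?case by simp
next
  case (step1 i)
  have "q (base + int n * (i + 1)) = loop \<otimes> q (base + int n * i)"
    using q_period[of "base + int n * i"] by (simp add: algebra_simps)
  then show ?case using step1 by (simp add: loop_pow_succ)
next
  case (step2 i)
  have "q (base + int n * i) = loop \<otimes> q (base + int n * (i - 1))"
    using q_period[of "base + int n * (i - 1)"] by (simp add: algebra_simps)
  then have "q (base + int n * (i - 1)) = inv loop \<otimes> loop [^] i"
    using step2 by (simp flip: m_assoc)
  also have "\<dots> = loop [^] (i - 1)"
    using loop_pow_succ[of "i - 1"] by (simp flip: m_assoc)
  finally show ?case by simp
qed

text \<open>The lift of a closed path at \<open>base\<close> ends at some \<open>base + n l\<close>,
  and its element is the power of \<open>loop\<close> with exponent \<open>l\<close>.\<close>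

lemma Gamma_Omega_loop: "loop \<in> Gamma_Omega W S (a base)" "generate W {loop} = Gamma_Omega W S (a base)"
proof -
  let ?P = "{path_elt W ts | ts. odd_path W S ts \<and> hd ts = a base \<and> last ts = a base}"
  let ?ts = "map (\<lambda>i. a (base + int i)) [0..<Suc n]"
  have "odd_path W S ?ts"
    using odd_edge_succ by (auto simp: odd_path_def add.assoc[symmetric] nth_append nth_Cons' simp del: upt_Suc)
      (metis add.commute add.left_commute)
  moreover have "hd ?ts = a base" by (simp add: hd_map del: upt_Suc)
  moreover have "last ?ts = a base" by simp
  moreover have "path_elt W ?ts = loop" by (simp add: path_elt_segment loop_def del: upt_Suc)
  ultimately have "loop \<in> ?P" by force
  then show loop: "loop \<in> Gamma_Omega W S (a base)"
    unfolding Gamma_Omega_def by (rule generate.incl)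
  have "?P \<subseteq> generate W {loop}"
  proof
    fix x assume "x \<in> ?P"
    then obtain ts where ts: "x = path_elt W ts" "odd_path W S ts" "hd ts = a base" "last ts = a base" by blast
    obtain k' where k': "a base = a k'" "x = inv (q base) \<otimes> q k'"
      using path_elt_q[OF ts(2,3)] ts by auto
    then obtain l where "k' = base + int n * l"
      by (metis a_eq_iff add_diff_cancel_left' diff_add_cancel dvdE dvd_diff_commute add.commute)
    then have "x = loop [^] l" using k' loop_power[of l] by simp
    then show "x \<in> generate W {loop}" using generate_pow[of loop] by auto
  qed
  then have "Gamma_Omega W S (a base) \<subseteq> generate W {loop}"
    unfolding Gamma_Omega_def by (intro generate_subgroup_incl generate_is_subgroup) simp_all
  moreover have "generate W {loop} \<subseteq> Gamma_Omega W S (a base)"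
    using \<open>loop \<in> ?P\<close> unfolding Gamma_Omega_def by (intro mono_generate) simp
  ultimately show "generate W {loop} = Gamma_Omega W S (a base)" by blast
qed

end

section \<open>Reflections commuting with a simple reflection\<close>

context group
begin

definition conjg :: "'a \<Rightarrow> 'a \<Rightarrow> 'a" where
  "conjg x y = x \<otimes> y \<otimes> inv x"

lemma conjg_closed [simp]: "\<lbrakk>x \<in> carrier G; y \<in> carrier G\<rbrakk> \<Longrightarrow> conjg x y \<in> carrier G"
  by (simp add: conjg_def)

lemma conjg_one [simp]: "y \<in> carrier G \<Longrightarrow> conjg \<one> y = y"
  by (simp add: conjg_def)

lemma conjg_conjg: "\<lbrakk>x \<in> carrier G; y \<in> carrier G; z \<in> carrier G\<rbrakk> \<Longrightarrow> conjg x (conjg y z) = conjg (x \<otimes> y) z"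
  by (simp add: conjg_def inv_mult_group m_assoc)

lemma conjg_mult:
  "\<lbrakk>x \<in> carrier G; y \<in> carrier G; z \<in> carrier G\<rbrakk> \<Longrightarrow> conjg x (y \<otimes> z) = conjg x y \<otimes> conjg x z"
  by (simp add: conjg_def m_assoc) (simp flip: m_assoc)

lemma conjg_eq_iff [simp]:
  "\<lbrakk>x \<in> carrier G; y \<in> carrier G; z \<in> carrier G\<rbrakk> \<Longrightarrow> conjg x y = conjg x z \<longleftrightarrow> y = z"
  by (simp add: conjg_def)

lemma conjg_commute_iff:
  "\<lbrakk>x \<in> carrier G; y \<in> carrier G; z \<in> carrier G\<rbrakk> \<Longrightarrow>
    conjg x y \<otimes> conjg x z = conjg x z \<otimes> conjg x y \<longleftrightarrow> y \<otimes> z = z \<otimes> y"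
  by (simp flip: conjg_mult)

end

lemma (in reflection_group) rep_conj_refl:
  assumes "w \<in> carrier G" "t \<in> carrier G" "\<And>v. \<rho> t v = refl \<tau> v"
  shows "\<rho> (conjg w t) v = refl (\<rho> w \<tau>) v"
proof -
  have "B (\<rho> (inv w) v) \<tau> = B v (\<rho> w \<tau>)"
    using rep_isometry[OF assms(1), of "\<rho> (inv w) v" \<tau>] assms by (simp add: rep_inv')
  then show ?thesis
    using assms by (simp add: conjg_def rep_mult refl_def rep_diff rep_scale rep_inv')
qed

context odd_cycle
begin

section \<open>Positive roots and conjugations that shorten a reflection\<close>

definition pos_root :: "('g \<Rightarrow> real) \<Rightarrow> bool" where
  "pos_root \<tau> \<longleftrightarrow> (\<exists>w\<in>carrier W. \<exists>s\<in>S. \<tau> = \<rho> w (simple_root s)) \<and> (\<forall>x. 0 \<le> \<tau> x)"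

lemma pos_root_norm: "pos_root \<tau> \<Longrightarrow> form \<tau> \<tau> = 1"
  by (auto simp: pos_root_def rep_isometry root_norm)

lemma simple_root_apply: "simple_root s x = (if x = s then 1 else 0)"
  by (simp add: simple_root_def)

lemma pos_root_other_coordinate:
  assumes "pos_root \<tau>" "x \<in> S" "\<tau> \<noteq> simple_root x"
  obtains y where "y \<noteq> x" "0 < \<tau> y"
proof -
  have "\<exists>y. y \<noteq> x \<and> 0 < \<tau> y"
  proof (rule ccontr)
    assume "\<not> ?thesis"
    then have 0: "\<tau> y = 0" if "y \<noteq> x" for y
      using that assms(1) by (metis less_eq_real_def pos_root_def)
    then have \<tau>: "\<tau> = \<tau> x *\<^sub>R simple_root x"
      by (auto simp: fun_eq_iff simple_root_apply)
    have "form \<tau> \<tau> = \<tau> x * \<tau> x"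
      by (subst (1 2) \<tau>) (simp add: scale_left scale_right root_norm assms)
    then have "\<tau> x = 1"
      using pos_root_norm[OF assms(1)] assms(1) by (simp add: pos_root_def square_eq_1_iff) (metis not_one_le_zero order.trans neg_0_le_iff_le)
    then show False using \<tau> assms(3) by simp
  qed
  then show thesis using that by blast
qed

lemma rep_root_sign: "\<lbrakk>w \<in> carrier W; s \<in> S\<rbrakk> \<Longrightarrow>
    (\<forall>x. 0 \<le> \<rho> w (simple_root s) x) \<or> (\<forall>x. \<rho> w (simple_root s) x \<le> 0)"
  using root_sign[of w s] by simp

text \<open>The reflection changes only the coordinate \<open>x\<close>, so a positive coordinate
  elsewhere survives; the coordinates of a root never have mixed signs.\<close>

lemma pos_root_refl:
  assumes \<tau>: "pos_root \<tau>" and x: "x \<in> S" and ne: "\<tau> \<noteq> simple_root x"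
  shows "pos_root (refl (simple_root x) \<tau>)"
proof -
  obtain y where y: "y \<noteq> x" "0 < \<tau> y" using pos_root_other_coordinate[OF assms] .
  obtain w s where w: "w \<in> carrier W" "s \<in> S" "\<tau> = \<rho> w (simple_root s)"
    using \<tau> by (auto simp: pos_root_def)
  have r: "refl (simple_root x) \<tau> = \<rho> (x \<otimes> w) (simple_root s)"
    using w x gen_closed[of x] by (simp add: rep_mult rep_gen)
  moreover have "refl (simple_root x) \<tau> y = \<tau> y"
    using y by (simp add: refl_def simple_root_apply)
  ultimately have "\<not> \<rho> (x \<otimes> w) (simple_root s) y \<le> 0" using y by simp
  then have "\<forall>x'. 0 \<le> \<rho> (x \<otimes> w) (simple_root s) x'"
    using rep_root_sign[of "x \<otimes> w" s] w x gen_closed[of x] by auto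
  then show ?thesis
    unfolding pos_root_def r using w x gen_closed[of x] by (intro conjI bexI[of _ "x \<otimes> w"] bexI[of _ s]) auto
qed

lemma simple_descent:
  "\<lbrakk>w \<in> carrier W; x \<in> S; \<rho> w (simple_root x) y < 0\<rbrakk> \<Longrightarrow> len (w \<otimes> x) < len w"
  by (rule root_descent) (auto simp: not_le)

text \<open>\<open>t\<close> gives the simple root of \<open>x\<close> a negative coordinate at some
  \<open>y \<noteq> x\<close>, so \<open>x\<close> is a descent of \<open>t\<close>. Multiplying by
  \<open>x\<close> on the left keeps that coordinate, so the length drops again on the other
  side.\<close>

lemma conjg_simple_shorter:
  assumes \<tau>: "pos_root \<tau>" and t: "t \<in> carrier W" "\<And>v. \<rho> t v = refl \<tau> v"
    and x: "x \<in> S" "\<tau> \<noteq> simple_root x" "0 < form \<tau> (simple_root x)"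
  shows "len (conjg x t) < len t"
proof -
  obtain y where y: "y \<noteq> x" "0 < \<tau> y" using pos_root_other_coordinate[OF \<tau> x(1,2)] .
  have xc: "x \<in> carrier W" using gen_closed x by simp
  have "t \<otimes> t = \<one>"
    using t \<tau> by (intro faithful_eq) (simp_all add: rep_mult rep_one pos_root_norm)
  then have inv_t: "inv t = t" using t by (simp add: inv_equality)
  have b: "form (simple_root x) \<tau> = form \<tau> (simple_root x)" by (rule sym)
  have "\<rho> t (simple_root x) y = - (2 * form \<tau> (simple_root x) * \<tau> y)"
    using t y by (simp add: refl_def b simple_root_apply)
  then have neg: "\<rho> t (simple_root x) y < 0" using y x by simp
  then have "len (t \<otimes> x) < len t"
    by (rule simple_descent[OF t(1) x(1)])
  moreover have "len (x \<otimes> t) = len (t \<otimes> x)"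
    using len_inv[of "t \<otimes> x"] t xc inv_t gen_inverse[OF x(1)] by (simp add: inv_mult_group)
  moreover have "\<rho> (x \<otimes> t) (simple_root x) y = \<rho> t (simple_root x) y"
    using t xc x y by (simp add: rep_mult rep_gen refl_def[of "simple_root x"] simple_root_apply)
  then have "len (x \<otimes> t \<otimes> x) < len (x \<otimes> t)"
    using simple_descent[of "x \<otimes> t" x y] t xc x neg by simp
  ultimately show ?thesis using gen_inverse[OF x(1)] by (simp add: conjg_def)
qed

lemma conjg_simple_le:
  assumes \<tau>: "pos_root \<tau>" and t: "t \<in> carrier W" "\<And>v. \<rho> t v = refl \<tau> v"
    and x: "x \<in> S" "\<tau> \<noteq> simple_root x" "0 \<le> form \<tau> (simple_root x)"
  shows "len (conjg x t) \<le> len t"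
proof (cases "form \<tau> (simple_root x) = 0")
  case True
  have xc: "x \<in> carrier W" using gen_closed x by simp
  have "conjg x t = t"
    using xc t x True by (intro faithful_eq) (simp_all add: rep_conj_refl[OF _ t] rep_gen refl_orth)
  then show ?thesis by simp
next
  case False
  then show ?thesis using conjg_simple_shorter[OF assms(1-5)] x by force
qed

text \<open>The conjugation proceeds letter by letter, starting with \<open>x\<close>. The product
  of the current root with the next simple root is a nonnegative Chebyshev value times the original
  positive product, so the first letter shortens the reflection and no later one lengthens
  it.\<close>

lemma conjg_alt_shorter:
  assumes \<tau>: "pos_root \<tau>" and t: "t \<in> carrier W" "\<And>v. \<rho> t v = refl \<tau> v"
    and p: "p \<in> S" "form \<tau> (simple_root p) = 0"
    and x: "x \<in> S" "0 < form \<tau> (simple_root x)"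
    and label: "form (simple_root p) (simple_root x) = - cos (pi / real l)" "odd l" "3 \<le> l"
    and k: "k \<le> l - 1"
  shows "pos_root (\<rho> (wprod (alt p x k)) \<tau>) \<and> len (conjg (wprod (alt p x k)) t) \<le> len t \<and>
    (1 \<le> k \<longrightarrow> len (conjg (wprod (alt p x k)) t) < len t)"
  using k
proof (induction k)
  case 0
  then show ?case using \<tau> t by (simp add: rep_one)
next
  case (Suc k)
  let ?u = "wprod (alt p x k)"
  define z where "z = (if even k then x else p)"
  define th where "th = pi / real l"
  have th: "real l * th = pi" using label by (simp add: th_def)
  have u: "?u \<in> carrier W" using p x by simp
  have z: "z \<in> S" "z \<in> carrier W" using p x gen_closed by (simp_all add: z_def)
  have u': "wprod (alt p x (Suc k)) = z \<otimes> ?u"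
    unfolding alt_Suc_left by (simp add: z_def)
  have inv_u: "inv ?u = wprod (if even k then alt x p k else alt p x k)"
    using wprod_rev[of "alt p x k"] p x by (simp add: rev_alt)
  have xp: "form (simple_root x) (simple_root p) = - cos th" "form (simple_root p) (simple_root x) = - cos th"
    using label by (simp_all add: sym[of "simple_root x"] th_def)
  have zu: "\<rho> (inv ?u) (simple_root z) = cheb (cos th) (Suc k) *\<^sub>R simple_root x + cheb (cos th) k *\<^sub>R simple_root p"
    unfolding inv_u z_def using p x root_norm xp by (simp add: rep_alt altr_first)
  have "form (\<rho> ?u \<tau>) (simple_root z) = form \<tau> (\<rho> (inv ?u) (simple_root z))"
    using rep_isometry[OF u, of \<tau> "\<rho> (inv ?u) (simple_root z)"] u by (simp add: rep_inv')
  also have "\<dots> = cheb (cos th) (Suc k) * form \<tau> (simple_root x)"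
    unfolding zu using p by (simp add: add_right scale_right)
  finally have fz: "form (\<rho> ?u \<tau>) (simple_root z) = cheb (cos th) (Suc k) * form \<tau> (simple_root x)" .
  have "0 \<le> cheb (cos th) (Suc k)"
    using Suc.prems label unfolding th_def by (intro cheb_cos_pi_nonneg) simp_all
  then have nonneg: "0 \<le> form (\<rho> ?u \<tau>) (simple_root z)" using x fz by simp
  \<comment> \<open>Otherwise \<tau> would be a root of the plane orthogonal to the root of
    \<open>p\<close>, which means \<open>(k + 1) pi / l = pi / 2\<close>; an odd \<open>l\<close>
    excludes this.\<close>
  have ne: "\<rho> ?u \<tau> \<noteq> simple_root z"
  proof
    assume "\<rho> ?u \<tau> = simple_root z"
    then have "\<tau> = \<rho> (inv ?u) (simple_root z)" using rep_inv[OF u] by metis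
    then have "cheb (cos th) k = cos th * cheb (cos th) (Suc k)"
      using p xp root_norm[OF p(1)] by (simp add: zu add_left scale_left)
    then have "sin th * cheb (cos th) k = cos th * (sin th * cheb (cos th) (Suc k))" by simp
    then have "sin (real k * th) = cos th * sin (real (Suc k) * th)" by (simp only: sin_cheb)
    moreover have "sin (real k * th) = sin (real (Suc k) * th - th)" by (simp add: algebra_simps)
    ultimately have "cos (real (Suc k) * th) * sin th = 0" by (simp add: sin_diff)
    moreover have "sin th \<noteq> 0" using sin_pi_over_pos[of l] label by (simp add: th_def)
    ultimately have cos0: "cos (real (Suc k) * th) = cos (pi / 2)" by simp
    have "real (Suc k) * th \<le> real l * th"
      using Suc.prems label by (intro mult_right_mono) (auto simp: th_def)
    then have "real (Suc k) * th = pi / 2"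
      using cos_inj_pi[OF _ _ _ _ cos0] th by (simp add: th_def del: of_nat_Suc)
    then have "real (2 * Suc k) * th = real l * th" using th by (simp add: algebra_simps)
    moreover have "th \<noteq> 0" using th by auto
    ultimately have "real (2 * Suc k) = real l" by simp
    then have "2 * Suc k = l" by (simp only: of_nat_eq_iff)
    then show False using label(2) by auto
  qed
  have IH: "pos_root (\<rho> ?u \<tau>)" "len (conjg ?u t) \<le> len t" "1 \<le> k \<longrightarrow> len (conjg ?u t) < len t"
    using Suc by simp_all
  have ct: "conjg ?u t \<in> carrier W" "\<And>v. \<rho> (conjg ?u t) v = refl (\<rho> ?u \<tau>) v"
    using u t rep_conj_refl[OF u t] by simp_all
  have "len (conjg z (conjg ?u t)) < len t"
  proof (cases "k = 0")
    case True
    then show ?thesis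
      using conjg_simple_shorter[OF IH(1) ct z(1) ne] x t \<tau> by (simp add: z_def rep_one)
  next
    case False
    then show ?thesis using conjg_simple_le[OF IH(1) ct z(1) ne nonneg] IH(3) by simp
  qed
  moreover have "pos_root (\<rho> (z \<otimes> ?u) \<tau>)"
    using pos_root_refl[OF IH(1) z(1) ne] u z by (simp add: rep_mult rep_gen)
  ultimately show ?case unfolding u' using u z t by (simp add: conjg_conjg)
qed

lemma e_pred_wprod: "inv (e k) = wprod (alt (a k) (a (k + 1)) (2 * ((m k - 1) div 2)))"
  unfolding e_wprod by (subst wprod_rev[symmetric]) (simp_all add: rev_alt)

text \<open>If \<open>\<rho> w (simple_root s)\<close> is negative, replacing \<open>w\<close> by
  \<open>w \<otimes> s\<close> changes its sign but not the reflection.\<close>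

lemma reflection_pos_root:
  assumes "t \<in> reflections W S"
  obtains \<tau> where "pos_root \<tau>" "t \<in> carrier W" "\<And>v. \<rho> t v = refl \<tau> v"
proof -
  obtain w s where w: "w \<in> carrier W" "s \<in> S" "t = w \<otimes> s \<otimes> inv w"
    using assms by (auto simp: reflections_def)
  have s: "s \<in> carrier W" using gen_closed w by simp
  have t: "t \<in> carrier W" "\<And>v. \<rho> t v = refl (\<rho> w (simple_root s)) v"
    using w s by (simp_all add: rep_conj_gen)
  show thesis
  proof (cases "\<forall>x. 0 \<le> \<rho> w (simple_root s) x")
    case True
    then have "pos_root (\<rho> w (simple_root s))" using w by (auto simp: pos_root_def)
    then show thesis using that t by blast
  next
    case False
    have eq: "\<rho> (w \<otimes> s) (simple_root s) = - \<rho> w (simple_root s)"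
      using rep_mult_gen_root w by simp
    then have "\<forall>x. 0 \<le> \<rho> (w \<otimes> s) (simple_root s) x"
      using False rep_root_sign[OF w(1,2)] by auto
    then have "pos_root (\<rho> (w \<otimes> s) (simple_root s))"
      unfolding pos_root_def using w s by blast
    moreover have "refl (- \<rho> w (simple_root s)) v = refl (\<rho> w (simple_root s)) v" for v
      by (simp add: refl_def minus_right)
    ultimately show thesis using that t eq by metis
  qed
qed

lemma conjg_reflection: "\<lbrakk>u \<in> carrier W; t \<in> reflections W S\<rbrakk> \<Longrightarrow> conjg u t \<in> reflections W S"
proof -
  assume u: "u \<in> carrier W" and "t \<in> reflections W S"
  then obtain w s where w: "w \<in> carrier W" "s \<in> S" "t = conjg w s"
    by (auto simp: reflections_def conjg_def)
  moreover have "s \<in> carrier W" using gen_closed w by simp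
  ultimately have "conjg u t = u \<otimes> w \<otimes> s \<otimes> inv (u \<otimes> w)"
    using u by (simp add: conjg_conjg) (simp add: conjg_def)
  then show ?thesis using u w unfolding reflections_def by blast
qed

text \<open>The norm 1 of \<tau> is the sum of its coordinates times its products with the simple
  roots, so some term is positive.\<close>

lemma pos_root_ex_descent:
  assumes "pos_root \<tau>"
  obtains y where "y \<in> S" "0 < form \<tau> (simple_root y)"
proof -
  have "\<exists>y\<in>S. 0 < \<tau> y * form \<tau> (simple_root y)"
  proof (rule ccontr)
    assume "\<not> ?thesis"
    then have "form \<tau> \<tau> \<le> 0"
      using coxeter_form_expand[OF finite_S, of W \<tau> \<tau>] by (simp add: not_less sum_nonpos)
    then show False using pos_root_norm[OF assms] by simp
  qed
  then show thesis using that assms by (metis linorder_not_less mult_nonneg_nonpos pos_root_def)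
qed

text \<open>If the product is nonzero, applying both orders to \<tau> makes
  \<open>\<alpha> k\<close> a multiple of \<tau>, and the two reflections coincide.\<close>

lemma commuting_root_orth:
  assumes \<tau>: "pos_root \<tau>" and t: "t \<in> carrier W" "\<And>v. \<rho> t v = refl \<tau> v"
    and comm: "t \<otimes> a k = a k \<otimes> t" and ne: "t \<noteq> a k"
  shows "form \<tau> (\<alpha> k) = 0"
proof (rule ccontr)
  define b where "b = form \<tau> (\<alpha> k)"
  assume "form \<tau> (\<alpha> k) \<noteq> 0"
  then have b: "b \<noteq> 0" by (simp add: b_def)
  note norm = pos_root_norm[OF \<tau>]
  have "refl \<tau> (refl (\<alpha> k) \<tau>) = refl (\<alpha> k) (refl \<tau> \<tau>)"
    using arg_cong[OF comm, of "\<lambda>w. \<rho> w \<tau>"] t by (simp add: rep_mult rep_gen)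
  moreover have "refl \<tau> (refl (\<alpha> k) \<tau>) = - \<tau> - (2 * b) *\<^sub>R (\<alpha> k - (2 * b) *\<^sub>R \<tau>)"
  proof -
    have "refl (\<alpha> k) \<tau> = \<tau> + (- 2 * b) *\<^sub>R \<alpha> k" by (simp add: refl_def b_def)
    moreover have "refl \<tau> (\<alpha> k) = \<alpha> k - (2 * b) *\<^sub>R \<tau>" by (simp add: refl_def b_def sym[of "\<alpha> k"])
    moreover have "refl \<tau> (\<tau> + (- 2 * b) *\<^sub>R \<alpha> k) = - \<tau> + (- 2 * b) *\<^sub>R refl \<tau> (\<alpha> k)"
      by (simp only: refl_add refl_scale refl_self norm)
    ultimately show ?thesis by simp
  qed
  moreover have "refl (\<alpha> k) (refl \<tau> \<tau>) = - \<tau> + (2 * b) *\<^sub>R \<alpha> k"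
    unfolding refl_self[OF norm] by (simp add: refl_def minus_left b_def)
  ultimately have eq: "- \<tau> - (2 * b) *\<^sub>R (\<alpha> k - (2 * b) *\<^sub>R \<tau>) = - \<tau> + (2 * b) *\<^sub>R \<alpha> k" by simp
  have "b * (b * \<tau> x) = b * \<alpha> k x" for x
    using fun_cong[OF eq, of x] by (simp add: algebra_simps)
  then have bt: "\<alpha> k = b *\<^sub>R \<tau>" using b by (auto simp: fun_eq_iff)
  then have "b * b = 1"
    using form_self[of k] norm by (simp add: scale_left scale_right)
  then have "refl (\<alpha> k) v = refl \<tau> v" for v
    unfolding bt by (simp add: refl_def scale_right algebra_simps flip: mult.assoc)
  then have "t = a k" using t by (intro faithful_eq) (simp_all add: rep_gen)
  then show False using ne by simp
qed

text \<open>Induction on length for all vertices \<open>k\<close> at once. A simple reflection whose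
  root has positive product with that of \<open>t\<close> is either adjacent to \<open>a k\<close>,
  and then \<open>e\<close> carries the problem to the neighbouring vertex, or commutes with
  \<open>a k\<close>, and then its conjugate by \<open>q k\<close> is some \<sigma> and can be
  stripped off.\<close>

theorem reflection_in_generate:
  assumes "t \<in> reflections W S" "t \<otimes> a k = a k \<otimes> t" "t \<noteq> a k"
  shows "conjg (q k) t \<in> generate W (range \<sigma>)"
  using assms
proof (induction "len t" arbitrary: t k rule: less_induct)
  case less
  have sub: "subgroup (generate W (range \<sigma>)) W" by (rule generate_is_subgroup) auto
  obtain \<tau> where \<tau>: "pos_root \<tau>" and t: "t \<in> carrier W" "\<And>v. \<rho> t v = refl \<tau> v"
    using reflection_pos_root[OF less.prems(1)] by metis
  have orth: "form \<tau> (\<alpha> k) = 0" using commuting_root_orth[OF \<tau> t less.prems(2,3)] .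
  obtain y where y: "y \<in> S" "0 < form \<tau> (simple_root y)" using pos_root_ex_descent[OF \<tau>] .
  obtain j where j: "k - 1 \<le> j" "j < k - 1 + int n" "y = a j" using S_residue[OF y(1)] by blast
  have "j \<noteq> k" using orth y j by auto
  then consider "j = k - 1" | "j = k + 1" | "2 \<le> j - k" "j - k \<le> int n - 2" using j by linarith
  then show ?case
  proof cases
    case 1
    have s: "a k = a (k - 1 + 1)" by simp
    have "len (conjg (e (k - 1)) t) < len t"
      using conjg_alt_shorter[OF \<tau> t, of "a k" "a (k - 1)" "m (k - 1)" "m (k - 1) - 1"]
        orth y j 1 m_odd[of "k - 1"] m_ge[of "k - 1"] half_m[of "k - 1"] form_succ(2)[of "k - 1"]
      by (simp add: e_wprod c_def)
    moreover have ek: "conjg (e (k - 1)) (a k) = a (k - 1)"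
      using e_conj[of "k - 1"] by (simp add: conjg_def)
    ultimately have "conjg (q (k - 1)) (conjg (e (k - 1)) t) \<in> generate W (range \<sigma>)"
      using less.prems t
      by (intro less.hyps) (simp_all add: conjg_reflection conjg_commute_iff flip: ek)
    then show ?thesis using q_succ[of "k - 1"] t by (simp add: conjg_conjg)
  next
    case 2
    have "len (conjg (inv (e k)) t) < len t"
      using conjg_alt_shorter[OF \<tau> t, of "a k" "a (k + 1)" "m k" "m k - 1"]
        orth y j 2 m_odd[of k] m_ge[of k] half_m[of k]
      by (simp add: e_pred_wprod c_def)
    moreover have ek: "conjg (inv (e k)) (a k) = a (k + 1)"
      using arg_cong[OF e_conj[of k, symmetric], of "conjg (inv (e k))"]
      by (simp add: conjg_conjg flip: conjg_def)
    ultimately have "conjg (q (k + 1)) (conjg (inv (e k)) t) \<in> generate W (range \<sigma>)"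
      using less.prems t
      by (intro less.hyps) (simp_all add: conjg_reflection conjg_commute_iff flip: ek)
    then show ?thesis using q_succ[of k] t by (simp add: conjg_conjg m_assoc)
  next
    case 3
    have aj: "a (j - int n) = a j" using a_period[of "j - int n"] by simp
    \<comment> \<open>The range of vertices for \<sigma> (j - n) runs from j - n + 2 to j - 2 and so
      contains \<open>k\<close>.\<close>
    have "\<sigma> (j - int n) = conjg (q k) (a j)"
      using \<sigma>_at[of "j - int n" k] 3 by (simp add: conjg_def aj)
    then have \<sigma>j: "conjg (q k) (a j) \<in> generate W (range \<sigma>)"
      by (metis generate.incl rangeI)
    show ?thesis
    proof (cases "\<tau> = \<alpha> j")
      case True
      then have "t = a j" using t by (intro faithful_eq) (simp_all add: rep_gen)
      then show ?thesis using \<sigma>j by simp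
    next
      case False
      have "len (conjg (a j) t) < len t"
        using conjg_simple_shorter[OF \<tau> t y(1)] False y j by simp
      moreover have jk: "conjg (a j) (a k) = a k"
        using commute_far[OF 3, symmetric] mult_gen_gen[of "a k" "a j"] by (simp add: conjg_def)
      have "conjg (a j) t \<otimes> a k = a k \<otimes> conjg (a j) t"
        using conjg_commute_iff[of "a j" t "a k"] less.prems t by (simp add: jk)
      moreover have "conjg (a j) t \<noteq> a k"
        using conjg_eq_iff[of "a j" t "a k"] less.prems t by (simp add: jk)
      ultimately have "conjg (q k) (conjg (a j) t) \<in> generate W (range \<sigma>)"
        using less.prems t by (intro less.hyps) (simp_all add: conjg_reflection)
      then have "conjg (q k) (a j) \<otimes> conjg (q k) (conjg (a j) t) \<otimes> conjg (q k) (a j) \<in> generate W (range \<sigma>)"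
        using \<sigma>j subgroup.m_closed[OF sub] by blast
      also have "conjg (q k) (a j) \<otimes> conjg (q k) (conjg (a j) t) \<otimes> conjg (q k) (a j) = conjg (q k) (a j \<otimes> conjg (a j) t \<otimes> a j)"
        using t by (simp add: conjg_mult)
      also have "a j \<otimes> conjg (a j) t \<otimes> a j = t"
        using t by (simp add: conjg_def m_assoc) (simp flip: m_assoc)
      finally show ?thesis .
    qed
  qed
qed

theorem W_Omega_generate: "W_Omega W S (a base) = generate W (range \<sigma>)"
proof
  have "t \<in> generate W (range \<sigma>)" if "t \<in> reflections W S \<inter> centralizer W (a base) - {a base}" for t
    using that reflection_in_generate[of t base] by (auto simp: centralizer_def)
  then show "W_Omega W S (a base) \<subseteq> generate W (range \<sigma>)"
    unfolding W_Omega_def by (intro generate_subgroup_incl generate_is_subgroup) auto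
  show "generate W (range \<sigma>) \<subseteq> W_Omega W S (a base)"
    unfolding W_Omega_def by (intro mono_generate image_subsetI) (rule \<sigma>_centralizes)
qed

end

section \<open>Inner products of the transported roots\<close>

text \<open>With x = cos (pi / 5), the identity cos (2 pi / 5) = - cos (3 pi / 5) becomes a cubic
  with the factor x + 1.\<close>

lemma cos_pi_5: "4 * (cos (pi / 5))\<^sup>2 = 2 * cos (pi / 5) + 1"
proof -
  define x where "x = cos (pi / 5)"
  have "cos (2 * (pi / 5)) = - cos (3 * (pi / 5))"
    using cos_minus_pi[of "2 * (pi / 5)"] cos_minus[of "3 * (pi / 5)"]
    by (simp add: cos_minus_pi field_simps)
  then have "2 * x\<^sup>2 - 1 = - (4 * x ^ 3 - 3 * x)"
    unfolding cos_double_cos cos_treble_cos x_def by (simp add: power_divide)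
  then have "(x + 1) * (4 * x\<^sup>2 - 2 * x - 1) = 0"
    by (simp add: algebra_simps power2_eq_square power3_eq_cube)
  moreover have "0 < x" unfolding x_def by (rule cos_gt_zero) simp_all
  ultimately have "4 * x\<^sup>2 - 2 * x - 1 = 0" by simp
  then show ?thesis by (simp add: x_def)
qed

lemma cos_pi_5_ge: "4 / 5 \<le> cos (pi / 5)"
proof (rule ccontr)
  define x where "x = cos (pi / 5)"
  assume "\<not> 4 / 5 \<le> cos (pi / 5)"
  then have "x < 4 / 5" by (simp add: x_def)
  have "0 < x" unfolding x_def by (rule cos_gt_zero) simp_all
  have "x * (4 * x - 2) < 1"
  proof (cases "x \<le> 1 / 2")
    case True
    then have "x * (4 * x - 2) \<le> 0" using \<open>0 < x\<close> by (intro mult_nonneg_nonpos) simp_all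
    then show ?thesis by simp
  next
    case False
    then have "x * (4 * x - 2) \<le> 4 / 5 * (4 * x - 2)" using \<open>x < 4 / 5\<close> by (intro mult_right_mono) simp_all
    then show ?thesis using \<open>x < 4 / 5\<close> by simp
  qed
  then show False using cos_pi_5 by (simp add: x_def power2_eq_square algebra_simps)
qed

context odd_cycle
begin

section \<open>Recursion for the transported roots\<close>

definition tr :: "int \<Rightarrow> int \<Rightarrow> 'g \<Rightarrow> real" where
  "tr y k = \<rho> (inv (q k)) (\<beta> y)"

text \<open>Here \<open>tr y k\<close> is \<beta> y as seen from vertex \<open>k\<close>. The minus
  sign turns products of at most -1 into lower bounds, and the recursion descends from
  \<open>k + 1\<close> to \<open>k\<close>, starting where \<beta> y looks like
  \<open>\<alpha> y\<close>.\<close>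

definition Y :: "int \<Rightarrow> int \<Rightarrow> int \<Rightarrow> real" where
  "Y y k p = - form (tr y k) (\<alpha> p)"

lemma q_tr: "\<rho> (q k) (tr y k) = \<beta> y"
  by (simp add: tr_def rep_inv')

lemma form_tr: "form (tr x k) (tr y k) = form (\<beta> x) (\<beta> y)"
  by (simp add: tr_def rep_isometry)

lemma tr_near: "\<lbrakk>y + 2 \<le> k; k \<le> y + int n - 2\<rbrakk> \<Longrightarrow> tr y k = \<alpha> y"
  by (simp add: tr_def \<beta>_at rep_inv)

lemma Y_period [simp]: "Y y k (p + int n) = Y y k p"
  by (simp add: Y_def)

lemma tr_orth: "form (tr y k) (\<alpha> k) = 0"
proof -
  have *: "form (tr y k) (\<alpha> k) = form (\<beta> y) (\<alpha> base)" for k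
    using rep_isometry[of "q k" "tr y k" "\<alpha> k"] by (simp add: q_tr q_root)
  have "form (tr y (y + 2)) (\<alpha> (y + 2)) = 0"
    using form_far(1)[of y "y + 2"] n_gt by (simp add: tr_near)
  then show ?thesis using * by simp
qed

text \<open>\<open>q k\<close> and \<open>q (k + 1)\<close> differ by \<open>e k\<close>, and the
  root seen from \<open>k + 1\<close> is orthogonal to \<open>\<alpha> (k + 1)\<close>, so
  \<open>e_transport\<close> applies.\<close>

lemma tr_step: "tr y k = tr y (k + 1) + (Y y (k + 1) k / (1 - c k)) *\<^sub>R (\<alpha> k + \<alpha> (k + 1))"
proof -
  have "tr y k = \<rho> (e k) (tr y (k + 1))"
    by (simp add: tr_def e_eq_q rep_mult rep_inv')
  then show ?thesis using e_transport[OF tr_orth[of y "k + 1"]] by (simp add: Y_def)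
qed

lemma Y_step: "Y y k p = Y y (k + 1) p - Y y (k + 1) k / (1 - c k) * (form (\<alpha> k) (\<alpha> p) + form (\<alpha> (k + 1)) (\<alpha> p))"
  unfolding Y_def[of y k] tr_step[of y k] by (simp add: form_simps Y_def)

lemma c_pos [simp]: "0 < c i" "0 < 1 - c i" "1 - c i \<noteq> 0" "0 \<le> c i" "c i < 1" "c i \<le> 1" "c i \<noteq> 1"
  using c_bounds[of i] by simp_all

lemma Y_step_up: "Y y k (k + 1) = - Y y (k + 1) k"
proof -
  have "Y y (k + 1) (k + 1) = 0" by (simp add: Y_def tr_orth)
  then have "Y y k (k + 1) = - (Y y (k + 1) k / (1 - c k) * (1 - c k))"
    using Y_step[of y k "k + 1"] by simp
  then show ?thesis using c_pos(3)[of k] by simp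
qed

lemma Y_step_down: "Y y k (k - 1) = Y y (k + 1) (k - 1) + Y y (k + 1) k * (c (k - 1) / (1 - c k))"
  using Y_step[of y k "k - 1"] form_succ(2)[of "k - 1"] form_far(2)[of "k - 1" "k + 1"] n_gt by simp

lemma Y_step_up2: "Y y k (k + 2) = Y y (k + 1) (k + 2) + Y y (k + 1) k * (c (k + 1) / (1 - c k))"
  using Y_step[of y k "k + 2"] form_succ(1)[of "k + 1"] form_far(1)[of k "k + 2"] n_gt by (simp add: add.assoc)

lemma Y_step_far: "\<lbrakk>k + 3 \<le> p; p \<le> k + int n - 2\<rbrakk> \<Longrightarrow> Y y k p = Y y (k + 1) p"
  using Y_step[of y k p] form_far(1)[of k p] form_far(1)[of "k + 1" p] by simp

lemma Y_near:
  "Y y (y + 2) y = - 1" "Y y (y + 2) (y + 1) = c y" "Y y (y + 2) (y - 1) = c (y - 1)"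
  "\<lbrakk>y + 2 \<le> p; p \<le> y + int n - 2\<rbrakk> \<Longrightarrow> Y y (y + 2) p = 0"
  using n_gt form_succ(2)[of "y - 1"] form_far(1)[of y p] by (simp_all add: Y_def tr_near)

lemma Y_near_nonneg:
  assumes p: "y + 2 \<le> p" "p \<le> y + int n - 1"
  shows "0 \<le> Y y (y + 2) p"
proof (cases "p = y - 1 + int n")
  case True
  then show ?thesis using Y_near(3)[of y] by (simp only: Y_period c_pos)
next
  case False
  then show ?thesis using Y_near(4)[of y p] p by simp
qed

text \<open>The value of \<open>Y y (y + 1) y\<close>: it is -1/2 if \<open>A3 y\<close> holds and
  at least 1/4 otherwise.\<close>

definition \<gamma> :: "int \<Rightarrow> real" where
  "\<gamma> y = c y * c y / (1 - c (y + 1)) - 1"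

lemma Y_1:
  "Y y (y + 1) y = \<gamma> y" "Y y (y + 1) (y + 2) = - c y"
  "Y y (y + 1) (y + 3) = Y y (y + 2) (y + 3) + c y * (c (y + 2) / (1 - c (y + 1)))"
  "\<lbrakk>y + 4 \<le> p; p \<le> y + int n - 1\<rbrakk> \<Longrightarrow> Y y (y + 1) p = Y y (y + 2) p"
proof -
  show "Y y (y + 1) y = \<gamma> y"
    using Y_step_down[of y "y + 1"] Y_near(1,2)[of y] by (simp add: \<gamma>_def add.assoc)
  show "Y y (y + 1) (y + 2) = - c y"
    using Y_step_up[of y "y + 1"] Y_near(2)[of y] by (simp add: add.assoc)
  show "Y y (y + 1) (y + 3) = Y y (y + 2) (y + 3) + c y * (c (y + 2) / (1 - c (y + 1)))"
    using Y_step_up2[of y "y + 1"] Y_near(2)[of y] by (simp add: add.assoc)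
  show "Y y (y + 1) p = Y y (y + 2) p" if "y + 4 \<le> p" "p \<le> y + int n - 1"
    using Y_step_far[of "y + 1" p y] that by (simp add: add.assoc)
qed

lemma Y_1_nonneg:
  assumes "y + 3 \<le> p" "p \<le> y + int n - 1"
  shows "0 \<le> Y y (y + 1) p"
proof (cases "p = y + 3")
  case True
  have "0 \<le> c y * (c (y + 2) / (1 - c (y + 1)))"
    using c_pos[of y] c_pos[of "y + 1"] c_pos[of "y + 2"] by simp
  then show ?thesis using True Y_1(3)[of y] Y_near_nonneg[of y p] assms by simp
next
  case False
  then show ?thesis using Y_1(4)[of y p] Y_near_nonneg[of y p] assms by simp
qed

text \<open>For n = 4 the vertices \<open>y - 1\<close> and \<open>y + 3\<close> coincide, which
  adds a nonnegative term; for larger \<open>n\<close> the step leaves the value unchanged.\<close>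

lemma Y_1_down: "c (y - 1) \<le> Y y (y + 1) (y - 1)"
proof (cases "n = 4")
  case True
  have "Y y (y + 1) (y - 1) = Y y (y + 1) (y + 3)" "Y y (y + 2) (y - 1) = Y y (y + 2) (y + 3)"
    using Y_period[of y _ "y - 1"] True by (simp_all add: add.commute)
  moreover have "0 \<le> c y * (c (y + 2) / (1 - c (y + 1)))"
    using c_pos[of y] c_pos[of "y + 1"] c_pos[of "y + 2"] by simp
  ultimately show ?thesis using Y_1(3)[of y] Y_near(3)[of y] by simp
next
  case False
  then have "Y y (y + 1) (y - 1 + int n) = Y y (y + 2) (y - 1 + int n)"
    using n_gt by (intro Y_1(4)) simp_all
  then show ?thesis using Y_near(3)[of y] by (simp only: Y_period)
qed

lemma Y_0:
  "Y y y (y + 1) = - \<gamma> y" "Y y y (y - 1) = Y y (y + 1) (y - 1) + \<gamma> y * (c (y - 1) / (1 - c y))"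
  "Y y y (y + 2) = - c y + \<gamma> y * (c (y + 1) / (1 - c y))"
  using Y_step_up[of y y] Y_step_down[of y y] Y_step_up2[of y y] Y_1[of y] by simp_all

lemma Y_0_nonneg: "\<lbrakk>y + 3 \<le> p; p \<le> y + int n - 2\<rbrakk> \<Longrightarrow> 0 \<le> Y y y p"
  using Y_step_far[of y p y] Y_1_nonneg[of y p] by simp

section \<open>Estimates in terms of the labels\<close>

definition A3 :: "int \<Rightarrow> bool" where
  "A3 i \<longleftrightarrow> m i = 3 \<and> m (i + 1) = 3"

definition H3 :: "int \<Rightarrow> bool" where
  "H3 i \<longleftrightarrow> m i = 3 \<and> m (i + 1) = 5 \<or> m i = 5 \<and> m (i + 1) = 3"

lemma c_3: "m i = 3 \<Longrightarrow> c i = 1 / 2"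
  by (simp add: c_def cos_60)

lemma c_5: "m i \<noteq> 3 \<Longrightarrow> 4 / 5 \<le> c i"
proof -
  assume "m i \<noteq> 3"
  then have "5 \<le> m i" using m_ge[of i] m_odd[of i] by (auto elim!: oddE)
  then have "cos (pi / 5) \<le> cos (pi / real (m i))"
    by (intro cos_monotone_0_pi_le) (auto simp: field_simps)
  then show ?thesis using cos_pi_5_ge by (simp add: c_def)
qed

text \<open>Comparison with label 6 suffices, because cos (pi / 6) is half the square root of
  3.\<close>

lemma c_7: "\<lbrakk>m i \<noteq> 3; m i \<noteq> 5\<rbrakk> \<Longrightarrow> 3 / 4 \<le> c i * c i"
proof -
  assume "m i \<noteq> 3" "m i \<noteq> 5"
  then have "6 \<le> m i" using m_ge[of i] m_odd[of i] by (auto elim!: oddE)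
  then have "cos (pi / 6) \<le> cos (pi / real (m i))"
    by (intro cos_monotone_0_pi_le) (auto simp: field_simps)
  then have "sqrt 3 / 2 \<le> c i" by (simp add: c_def cos_30)
  then have "sqrt 3 / 2 * (sqrt 3 / 2) \<le> c i * c i" by (intro mult_mono) simp_all
  then show ?thesis by simp
qed

lemma ratio_ge_1: "1 \<le> c i / (1 - c j)"
  using c_bounds[of i] c_bounds[of j] by (simp add: field_simps)

lemma ratio_ge_4: "m i \<noteq> 3 \<Longrightarrow> 4 \<le> c i / (1 - c i)"
  using c_5[of i] c_bounds[of i] by (simp add: field_simps)

lemma c_product_ge:
  assumes "m i \<noteq> 3 \<or> m j \<noteq> 3"
  shows "4 \<le> (c i / (1 - c i)) * (c j / (1 - c j))"
proof -
  have *: "4 \<le> x * y" if "4 \<le> x \<and> 1 \<le> y \<or> 1 \<le> x \<and> 4 \<le> y" for x y :: real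
    using that mult_mono[of 4 x 1 y] mult_mono[of 1 x 4 y] by auto
  show ?thesis using assms ratio_ge_4 ratio_ge_1 by (intro *) blast
qed

lemma \<gamma>_ge: "\<not> A3 y \<Longrightarrow> 1 / 4 \<le> \<gamma> y"
proof -
  assume nA: "\<not> A3 y"
  have b: "c y < 1" "0 < 1 - c (y + 1)" "1 / 2 \<le> c y" "1 / 2 \<le> c (y + 1)"
    using c_bounds c_pos by auto
  have "5 / 4 * (1 - c (y + 1)) \<le> c y * c y"
  proof (cases "m y = 3")
    case True
    then have "4 / 5 \<le> c (y + 1)" using nA c_5 by (simp add: A3_def)
    moreover have "c y * c y = 1 / 4" unfolding c_3[OF True] by simp
    ultimately show ?thesis by simp
  next
    case False
    then have "4 / 5 * (4 / 5) \<le> c y * c y" using c_5[OF False] by (intro mult_mono) simp_all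
    then show ?thesis using b by simp
  qed
  then have "5 / 4 \<le> c y * c y / (1 - c (y + 1))" using b by (simp add: pos_le_divide_eq)
  then show ?thesis by (simp add: \<gamma>_def)
qed

text \<open>Clearing denominators in the quantity that measures the product of \<beta> y and \<beta>
  (y + 2 - n) gives a symmetric polynomial in the two cosines.\<close>

lemma Y_0_eq: "Y y y (y + 2) * ((1 - c y) * (1 - c (y + 1))) = (c y)\<^sup>2 + (c (y + 1))\<^sup>2 + c y * c (y + 1) - c y - c (y + 1)"
proof -
  define d where "d = 1 - c (y + 1)"
  have A: "\<gamma> y * d = c y * c y - d"
    using c_pos[of "y + 1"] by (simp add: \<gamma>_def d_def left_diff_distrib)
  have "Y y y (y + 2) * (1 - c y) = - c y * (1 - c y) + \<gamma> y * c (y + 1)"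
    using c_pos[of y] unfolding Y_0 by (simp add: left_diff_distrib distrib_right)
  then have "Y y y (y + 2) * (1 - c y) * d = (- c y * (1 - c y) + \<gamma> y * c (y + 1)) * d"
    by simp
  then have "Y y y (y + 2) * ((1 - c y) * d) = - c y * (1 - c y) * d + (\<gamma> y * d) * c (y + 1)"
    by (simp only: mult.assoc distrib_right mult.commute[of d])
  then show ?thesis unfolding A by (simp add: d_def algebra_simps power2_eq_square)
qed

lemma Y_0_H3: "H3 y \<Longrightarrow> Y y y (y + 2) = 0"
proof -
  assume "H3 y"
  then have "c y = 1 / 2 \<and> c (y + 1) = cos (pi / 5) \<or> c y = cos (pi / 5) \<and> c (y + 1) = 1 / 2"
    by (auto simp: H3_def c_def cos_60)
  then have "(c y)\<^sup>2 + (c (y + 1))\<^sup>2 + c y * c (y + 1) - c y - c (y + 1) = 0"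
  proof (elim disjE conjE)
    assume c: "c y = 1 / 2" "c (y + 1) = cos (pi / 5)"
    show ?thesis unfolding c using cos_pi_5 by (simp add: power_divide)
  next
    assume c: "c y = cos (pi / 5)" "c (y + 1) = 1 / 2"
    show ?thesis unfolding c using cos_pi_5 by (simp add: power_divide)
  qed
  then show ?thesis
    using Y_0_eq[of y] c_pos[of y] c_pos[of "y + 1"] by simp
qed

text \<open>By \<open>Y_0_eq\<close> the bound says that the squares of the two cosines add up to at
  least 1. Labels 3 and at least 7 give 1/4 + 3/4, and two labels of at least 5 give at least 2
  (4/5)^2.\<close>

lemma Y_0_ge: "\<lbrakk>\<not> A3 y; \<not> H3 y\<rbrakk> \<Longrightarrow> 1 \<le> Y y y (y + 2)"
proof -
  assume nA: "\<not> A3 y" and nH: "\<not> H3 y"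
  have sq: "1 / 4 \<le> c i * c i" for i using mult_mono[OF c_bounds(1) c_bounds(1), of i i] by simp
  have sq5: "m i \<noteq> 3 \<Longrightarrow> 4 / 5 * (4 / 5) \<le> c i * c i" for i
    using mult_mono[OF c_5 c_5, of i i] c_pos[of i] by simp
  have "1 \<le> c y * c y + c (y + 1) * c (y + 1)"
  proof (cases "m y = 3 \<or> m (y + 1) = 3")
    case True
    then have "3 / 4 \<le> c y * c y \<or> 3 / 4 \<le> c (y + 1) * c (y + 1)"
      using nA nH c_7[of y] c_7[of "y + 1"] by (auto simp: A3_def H3_def)
    then show ?thesis using sq[of y] sq[of "y + 1"] by auto
  next
    case False
    then show ?thesis using sq5[of y] sq5[of "y + 1"] by simp
  qed
  then have "1 * ((1 - c y) * (1 - c (y + 1))) \<le> Y y y (y + 2) * ((1 - c y) * (1 - c (y + 1)))"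
    unfolding Y_0_eq by (simp add: algebra_simps power2_eq_square)
  then show ?thesis
    using mult_pos_pos[OF c_pos(2)[of y] c_pos(2)[of "y + 1"]] by (simp only: mult_le_cancel_right_pos)
qed

text \<open>The invariant is preserved, with a larger \<open>g\<close>, when \<open>k\<close> decreases, because \<open>c \<ge> 1 / 2\<close> makes all
  ratios \<open>c i / (1 - c j)\<close> at least \<open>1\<close>.\<close>

definition Inv :: "int \<Rightarrow> int \<Rightarrow> real \<Rightarrow> bool" where
  "Inv y k g \<longleftrightarrow> 0 < g \<and> Y y k (k + 1) = - g \<and> g * (c (k - 1) / (1 - c k)) \<le> Y y k (k - 1) \<and>
    (\<forall>p. k + 2 \<le> p \<and> p \<le> k + int n - 2 \<longrightarrow> 0 \<le> Y y k p)"

lemma Inv_start: "\<not> A3 y \<Longrightarrow> Inv y y (\<gamma> y)"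
proof -
  assume nA: "\<not> A3 y"
  have "0 \<le> Y y y (y + 2)" using Y_0_H3[of y] Y_0_ge[OF nA] by force
  then have "0 \<le> Y y y p" if "y + 2 \<le> p" "p \<le> y + int n - 2" for p
    using Y_0_nonneg[of y p] that by (cases "p = y + 2") simp_all
  moreover have "0 \<le> Y y (y + 1) (y - 1)" using Y_1_down[of y] c_pos[of "y - 1"] by linarith
  ultimately show ?thesis
    unfolding Inv_def using \<gamma>_ge[OF nA] Y_0[of y] by simp
qed

lemma Inv_step_bound:
  assumes "Inv y (k + 1) g"
  shows "g * ((c k / (1 - c k)) * (c (k + 1) / (1 - c (k + 1))) - 1) \<le> Y y k (k + 2)"
proof -
  have "Y y (k + 1) (k + 2) = - g"
    using assms by (simp add: Inv_def add.assoc)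
  then have "Y y k (k + 2) = - g + Y y (k + 1) k * (c (k + 1) / (1 - c k))"
    by (simp add: Y_step_up2)
  moreover have "g * (c k / (1 - c (k + 1))) * (c (k + 1) / (1 - c k)) \<le> Y y (k + 1) k * (c (k + 1) / (1 - c k))"
    using assms c_pos[of "k + 1"] c_pos[of k] by (intro mult_right_mono) (simp_all add: Inv_def)
  ultimately show ?thesis by (simp add: algebra_simps)
qed

lemma Inv_step:
  assumes inv: "Inv y (k + 1) g"
  shows "Inv y k (Y y (k + 1) k)" "g \<le> Y y (k + 1) k"
proof -
  have g: "0 < g" "g * (c k / (1 - c (k + 1))) \<le> Y y (k + 1) k"
    "\<And>p. \<lbrakk>k + 3 \<le> p; p \<le> k + int n - 1\<rbrakk> \<Longrightarrow> 0 \<le> Y y (k + 1) p"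
    using inv by (auto simp: Inv_def)
  have "g * 1 \<le> g * (c k / (1 - c (k + 1)))"
    using g ratio_ge_1 by (intro mult_left_mono) simp_all
  then show le: "g \<le> Y y (k + 1) k" using g by simp
  have "1 * 1 \<le> (c k / (1 - c k)) * (c (k + 1) / (1 - c (k + 1)))"
    using ratio_ge_1 by (intro mult_mono) (simp_all add: order.trans[OF zero_le_one])
  then have "0 \<le> g * ((c k / (1 - c k)) * (c (k + 1) / (1 - c (k + 1))) - 1)" using g by simp
  then have "0 \<le> Y y k (k + 2)" using Inv_step_bound[OF inv] by simp
  then have "0 \<le> Y y k p" if "k + 2 \<le> p" "p \<le> k + int n - 2" for p
    using that g(3)[of p] Y_step_far[of k p y] by (cases "p = k + 2") simp_all
  moreover have "0 \<le> Y y (k + 1) (k - 1)"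
    using g(3)[of "k - 1 + int n"] n_gt by simp
  ultimately show "Inv y k (Y y (k + 1) k)"
    unfolding Inv_def using le g(1) Y_step_up[of y k] Y_step_down[of y k] by simp
qed

text \<open>The start \<gamma> y is only known to be at least 1/4; the first step below
  \<open>y\<close> contributes a further \<open>c (y - 1)\<close>, at least 1/2, and afterwards
  \<open>g\<close> does not decrease.\<close>

lemma Inv_below:
  assumes nA: "\<not> A3 y" and "k \<le> y"
  shows "\<exists>g. Inv y k g \<and> (k \<le> y - 1 \<longrightarrow> 3 / 4 \<le> g)"
  using assms(2)
proof (induction k rule: int_le_induct)
  case base
  then show ?case using Inv_start[OF nA] by auto
next
  case (step k)
  then obtain g where g: "Inv y (k - 1 + 1) g" "k \<le> y - 1 \<longrightarrow> 3 / 4 \<le> g" by auto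
  have "3 / 4 \<le> Y y (k - 1 + 1) (k - 1)"
  proof (cases "k = y")
    case True
    have "\<gamma> y * 1 \<le> \<gamma> y * (c (y - 1) / (1 - c y))"
      using \<gamma>_ge[OF nA] ratio_ge_1 by (intro mult_left_mono) simp_all
    then show ?thesis
      using True Y_0(2)[of y] Y_1_down[of y] c_bounds(1)[of "y - 1"] \<gamma>_ge[OF nA] by simp
  next
    case False
    then show ?thesis using g Inv_step(2)[OF g(1)] step by simp
  qed
  then show ?case using Inv_step(1)[OF g(1)] by auto
qed

text \<open>As \<open>A3 k\<close> fails, the product of the two ratios is at least 4. Directly
  below \<open>y\<close> this gives at least 4/5 + 3 \<gamma> y, and further down at least 3/4 times
  3.\<close>

lemma Y_far_ge:
  assumes nA: "\<not> A3 y" "\<not> A3 k" and k: "k < y"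
  shows "1 \<le> Y y k (k + 2)"
proof -
  have R: "4 \<le> (c k / (1 - c k)) * (c (k + 1) / (1 - c (k + 1)))"
    using nA(2) by (intro c_product_ge) (auto simp: A3_def)
  show ?thesis
  proof (cases "k + 1 = y")
    case True
    have kp: "k = y - 1" using True by simp
    have "Y y k (k + 2) = - \<gamma> y + Y y y k * (c y / (1 - c k))"
    proof -
      have "k + 2 = y + 1" using True by simp
      then show ?thesis using Y_step_up2[of y k] Y_0(1)[of y] by (simp only: True)
    qed
    moreover have "(c k + \<gamma> y * (c k / (1 - c y))) * (c y / (1 - c k)) \<le> Y y y k * (c y / (1 - c k))"
      using Y_0(2)[of y] Y_1_down[of y] by (intro mult_right_mono) (simp_all add: kp)
    moreover have "(c k + \<gamma> y * (c k / (1 - c y))) * (c y / (1 - c k)) =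
        (c k / (1 - c k)) * c y + \<gamma> y * ((c k / (1 - c k)) * (c (k + 1) / (1 - c (k + 1))))"
      unfolding True by (simp add: divide_inverse distrib_left distrib_right mult_ac)
    moreover have "\<gamma> y * 4 \<le> \<gamma> y * ((c k / (1 - c k)) * (c (k + 1) / (1 - c (k + 1))))"
      using R \<gamma>_ge[OF nA(1)] by (intro mult_left_mono) simp_all
    moreover have "4 / 5 \<le> (c k / (1 - c k)) * c y"
    proof (cases "m k = 3")
      case True
      then have "m y \<noteq> 3" using nA(2) by (auto simp: A3_def kp)
      then show ?thesis
        using mult_mono[OF ratio_ge_1[of k k] c_5[of y]] c_pos[of k] by simp
    next
      case False
      then have "4 * (1 / 2) \<le> (c k / (1 - c k)) * c y"
        by (intro mult_mono ratio_ge_4 c_bounds) simp_all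
      then show ?thesis by linarith
    qed
    ultimately show ?thesis using \<gamma>_ge[OF nA(1)] by linarith
  next
    case False
    then obtain g where g: "Inv y (k + 1) g" "3 / 4 \<le> g"
      using Inv_below[OF nA(1), of "k + 1"] k by auto
    have "3 / 4 * 3 \<le> g * ((c k / (1 - c k)) * (c (k + 1) / (1 - c (k + 1))) - 1)"
      using g R by (intro mult_mono) simp_all
    then show ?thesis using Inv_step_bound[OF g(1)] by linarith
  qed
qed

text \<open>Vertex \<open>k\<close> is the last one in the range where \<beta> x looks like
  \<open>\<alpha> x\<close>, and \<open>\<alpha> x\<close> equals \<open>\<alpha> (k + 2)\<close> by
  periodicity.\<close>

lemma form_Y:
  assumes "x + int n - 2 = k"
  shows "form (\<beta> x) (\<beta> y) = - Y y k (k + 2)"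
proof -
  have "tr x k = \<alpha> x" using assms n_gt by (intro tr_near) simp_all
  moreover have "\<alpha> (k + 2) = \<alpha> x" using assms by (simp flip: a_period[of x] add: algebra_simps)
  ultimately show ?thesis using form_tr[of x k y] by (simp add: Y_def sym[of "\<alpha> x"])
qed

lemma tr_1: "tr y (y + 1) = \<alpha> y + (c y / (1 - c (y + 1))) *\<^sub>R (\<alpha> (y + 1) + \<alpha> (y + 2))"
  using tr_step[of y "y + 1"] tr_near[of y "y + 2"] n_gt Y_near(2)[of y] by (simp add: add.assoc)

text \<open>With both cosines equal to 1/2, two steps of the recursion turn
  \<open>\<alpha> y\<close> into \<open>\<alpha> (y + 2)\<close>, which is \<beta> (y + 2 - n) seen
  from \<open>y\<close>. This is the source of relation (iii).\<close>

lemma A3_root: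
  assumes "A3 y"
  shows "\<beta> y = \<beta> (y + 2 - int n)"
proof -
  have c: "c y = 1 / 2" "c (y + 1) = 1 / 2" using assms c_3 by (auto simp: A3_def)
  have "\<gamma> y = - (1 / 2)" by (simp add: \<gamma>_def c)
  then have "tr y y = \<alpha> (y + 2)"
    using tr_step[of y y] by (simp add: tr_1 Y_1(1) c)
  also have "\<dots> = tr (y + 2 - int n) y"
    using n_gt by (simp add: tr_near)
  finally show ?thesis by (metis q_tr)
qed

text \<open>Descending adds nonnegative multiples of simple roots, except that below
  \<open>y + 1\<close> with \<open>A3 y\<close> the root is renamed \<beta> (y + 2 - n) and the
  measure drops by n - 2.\<close>

lemma tr_nonneg: "k \<le> y + int n - 2 \<Longrightarrow> 0 \<le> tr y k s"
proof (induction "nat (y + int n - 2 - k)" arbitrary: y k rule: less_induct)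
  case less
  have root: "0 \<le> \<alpha> i s" for i by (simp add: simple_root_apply)
  consider "y + 2 \<le> k" | "k = y + 1" | "k \<le> y" "A3 y" | "k \<le> y" "\<not> A3 y" by linarith
  then show ?case
  proof cases
    case 1
    then show ?thesis using less root by (simp add: tr_near)
  next
    case 2
    then show ?thesis using root by (simp add: tr_1)
  next
    case 3
    have "0 \<le> tr (y + 2 - int n) k s" using less 3 n_gt by simp
    then show ?thesis using A3_root[OF 3(2)] by (simp add: tr_def)
  next
    case 4
    have IH: "0 \<le> tr y (k + 1) s" using less 4 n_gt by simp
    have "0 \<le> Y y (k + 1) k"
    proof (cases "k = y")
      case True
      then show ?thesis using Y_1(1)[of y] \<gamma>_ge[OF 4(2)] by simp
    next
      case False
      then obtain g where "Inv y (k + 1) g" using Inv_below[OF 4(2), of "k + 1"] 4 by auto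
      then show ?thesis using Inv_step(2)[of y k g] by (simp add: Inv_def)
    qed
    then show ?thesis using IH root c_pos[of k] by (simp add: tr_step[of y k])
  qed
qed

text \<open>The first pair beyond the range of relation (i). For n = 4 the wrap around the cycle
  supplies an extra \<open>c (y - 1)\<close>; otherwise the failure of \<open>A3\<close> at
  \<open>y\<close> and \<open>y + 1\<close> gives
  \<open>1 - c (y + 1) \<le> c y * c (y + 2)\<close>.\<close>

lemma form_adjacent_le:
  assumes d: "y = x + int n - 3" and "n = 4 \<or> \<not> A3 y \<and> \<not> A3 (y + 1)"
  shows "form (\<beta> x) (\<beta> y) \<le> - 1"
proof -
  have f: "form (\<beta> x) (\<beta> y) = - (Y y (y + 2) (y + 3) + c y * (c (y + 2) / (1 - c (y + 1))))"
    using form_Y[of x "y + 1" y] d Y_1(3)[of y] by (simp add: add.assoc)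
  have eq: "c y * (c (y + 2) / (1 - c (y + 1))) = c y * c (y + 2) / (1 - c (y + 1))" by simp
  show ?thesis
  proof (cases "n = 4")
    case True
    have "Y y (y + 2) (y + 3) = c (y - 1)"
      using Y_period[of y "y + 2" "y - 1"] Y_near(3)[of y] True by (simp add: add.commute)
    moreover have "1 / 2 * 1 \<le> c y * (c (y + 2) / (1 - c (y + 1)))"
      using c_bounds[of y] ratio_ge_1 by (intro mult_mono) simp_all
    ultimately show ?thesis unfolding f using c_bounds(1)[of "y - 1"] by linarith
  next
    case False
    then have nA: "\<not> A3 y" "\<not> A3 (y + 1)" using assms by auto
    have "1 - c (y + 1) \<le> c y * c (y + 2)"
    proof (cases "m (y + 1) = 3")
      case True
      then have "m y \<noteq> 3" "m (y + 2) \<noteq> 3" using nA by (auto simp: A3_def add.assoc)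
      then have "4 / 5 * (4 / 5) \<le> c y * c (y + 2)" using c_5 by (intro mult_mono) simp_all
      then show ?thesis using c_3[OF True] by simp
    next
      case False
      have "1 / 2 * (1 / 2) \<le> c y * c (y + 2)" using c_bounds by (intro mult_mono) simp_all
      then show ?thesis using c_5[OF False] by simp
    qed
    then have "1 \<le> c y * c (y + 2) / (1 - c (y + 1))"
      using c_pos[of "y + 1"] by (simp add: pos_le_divide_eq)
    moreover have "0 \<le> Y y (y + 2) (y + 3)" using n_gt by (intro Y_near_nonneg) simp_all
    ultimately show ?thesis unfolding f eq by linarith
  qed
qed

text \<open>Both roots look simple from vertex \<open>y + 2\<close> as long as the indices differ by
  at most n - 4, which explains the bound in relation (i).\<close>

lemma form_near:
  assumes "x \<le> y" "y - x \<le> int n - 4"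
  shows "form (\<beta> x) (\<beta> y) = form (\<alpha> x) (\<alpha> y)"
  using form_tr[of x "y + 2" y] assms n_gt by (simp add: tr_near)

lemma label_near:
  assumes "x < y" "y - x \<le> int n - 4"
  shows "2 \<le> coxeter_label W (a x) (a y)"
proof (cases "y = x + 1")
  case True
  then show ?thesis using m_ge[of x] by (simp add: m_def)
next
  case False
  have "coxeter_label W (a x) (a y) = 2"
    by (rule label_far; use False assms in linarith)
  then show ?thesis by simp
qed

end

section \<open>The presentation\<close>

lemma presented_group_word_val:
  assumes "w \<in> words X"
  shows "word_val (presented_group X R) (\<lambda>x. word_class X R [gen x]) w = word_class X R w"
  using assms
proof (induction w)
  case Nil
  interpret group "presented_group X R" by (rule group_presented_group)
  show ?case by (simp add: one_presented_group)
next
  case (Cons p w)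
  interpret group "presented_group X R" by (rule group_presented_group)
  obtain x b where p: "p = (x, b)" by (cases p)
  have x: "x \<in> X" and w: "w \<in> words X" using Cons.prems p by auto
  have mem: "word_class X R [(x, b)] \<in> carrier (presented_group X R)" for b
    using x by (simp add: carrier_presented_group)
  have "word_equiv X R [(x, False), (x, True)] []"
    using word_equiv_cancel[of "[]" X "[]" x R False] x by simp
  then have "word_class X R [gen_inv x] \<otimes>\<^bsub>presented_group X R\<^esub> word_class X R [gen x] = \<one>\<^bsub>presented_group X R\<^esub>"
    using x by (simp add: mult_word_class one_presented_group word_class_eq_iff)
  then have "inv\<^bsub>presented_group X R\<^esub> word_class X R [gen x] = word_class X R [gen_inv x]"
    by (rule inv_equality) (rule mem)+
  then show ?case
    using Cons.IH[OF w] w x p by (cases b) (simp_all add: mult_word_class)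
qed

lemma presented_group_relator:
  assumes "r \<in> R" "r \<in> words X"
  shows "word_val (presented_group X R) (\<lambda>x. word_class X R [gen x]) r = \<one>\<^bsub>presented_group X R\<^esub>"
  using assms word_equiv_relator[of "[]" X "[]" r R]
  by (simp add: presented_group_word_val one_presented_group word_class_eq_iff)

lemma presented_group_generate:
  "generate (presented_group X R) ((\<lambda>x. word_class X R [gen x]) ` X) = carrier (presented_group X R)"
proof
  interpret group "presented_group X R" by (rule group_presented_group)
  let ?g = "\<lambda>x. word_class X R [gen x]"
  have g: "?g ` X \<subseteq> carrier (presented_group X R)" by (auto simp: carrier_presented_group)
  then show "generate (presented_group X R) (?g ` X) \<subseteq> carrier (presented_group X R)"
    by (rule generate_incl)
  have "word_val (presented_group X R) ?g w \<in> generate (presented_group X R) (?g ` X)" if "w \<in> words X" for w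
    using that
  proof (induction w)
    case Nil
    show ?case by (simp add: generate.one)
  next
    case (Cons p w)
    then show ?case by (cases p) (auto intro: generate.intros)
  qed
  then show "carrier (presented_group X R) \<subseteq> generate (presented_group X R) (?g ` X)"
    by (auto simp: carrier_presented_group presented_group_word_val)
qed

section \<open>The presented group as a reflection group on the roots \<beta> j\<close>

context odd_cycle
begin

lemma type_A3_iff: "type_A3 W (a i) (a (i + 1)) (a (i + 2)) \<longleftrightarrow> A3 i"
  by (simp add: type_A3_def A3_def m_def add.assoc)

lemma type_H3_iff: "type_H3 W (a i) (a (i + 1)) (a (i + 2)) \<longleftrightarrow> H3 i"
  by (simp add: type_H3_def H3_def m_def add.assoc)

lemma label_self: "coxeter_label W (a i) (a i) = 1"
  using ord_eq_1[of \<one>] by (simp add: coxeter_label_def)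

text \<open>Stated for elements of any group satisfying the cycle relators, so that it applies to
  the presented group. Induction on the distance of the indices: type \<open>A3\<close> at
  \<open>y\<close> or at \<open>x + n - 2\<close> renames one index and brings the pair closer;
  explicit values and bounds settle the remaining pairs.\<close>

lemma root_pair_cases:
  fixes H :: "('h, 'k) monoid_scheme" (structure) and g :: "int \<Rightarrow> 'h"
  assumes H: "group H" and g: "\<And>i. g i \<in> carrier H"
    and near: "\<And>i j. \<bar>i - j\<bar> \<le> int n - 4 \<Longrightarrow> (g i \<otimes>\<^bsub>H\<^esub> g j) [^]\<^bsub>H\<^esub> coxeter_label W (a i) (a j) = \<one>\<^bsub>H\<^esub>"
    and H3: "\<And>i. H3 i \<Longrightarrow> (g i \<otimes>\<^bsub>H\<^esub> g (i + 2 - int n)) [^]\<^bsub>H\<^esub> (2::nat) = \<one>\<^bsub>H\<^esub>"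
    and A3: "\<And>i. A3 i \<Longrightarrow> g i = g (i + 2 - int n)"
  shows "g x = g y \<and> \<beta> x = \<beta> y \<or>
    (\<exists>l\<ge>2. (g x \<otimes>\<^bsub>H\<^esub> g y) [^]\<^bsub>H\<^esub> (l::nat) = \<one>\<^bsub>H\<^esub> \<and> form (\<beta> x) (\<beta> y) = - cos (pi / real l)) \<or>
    form (\<beta> x) (\<beta> y) \<le> - 1"
proof -
  interpret H: group H by (rule H)
  define P where "P x y \<longleftrightarrow> g x = g y \<and> \<beta> x = \<beta> y \<or>
    (\<exists>l\<ge>2. (g x \<otimes>\<^bsub>H\<^esub> g y) [^]\<^bsub>H\<^esub> (l::nat) = \<one>\<^bsub>H\<^esub> \<and> form (\<beta> x) (\<beta> y) = - cos (pi / real l)) \<or>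
    form (\<beta> x) (\<beta> y) \<le> - 1" for x y
  have "g i \<otimes>\<^bsub>H\<^esub> g i = \<one>\<^bsub>H\<^esub>" for i
    using near[of i i] n_gt g by (simp add: label_self)
  then have inv: "inv\<^bsub>H\<^esub> (g i) = g i" for i using g by (simp add: H.inv_equality)
  have swap: "(g y \<otimes>\<^bsub>H\<^esub> g x) [^]\<^bsub>H\<^esub> (l::nat) = \<one>\<^bsub>H\<^esub>" if "(g x \<otimes>\<^bsub>H\<^esub> g y) [^]\<^bsub>H\<^esub> l = \<one>\<^bsub>H\<^esub>" for x y l
  proof -
    have "g y \<otimes>\<^bsub>H\<^esub> g x = inv\<^bsub>H\<^esub> (g x \<otimes>\<^bsub>H\<^esub> g y)" using g by (simp add: H.inv_mult_group inv)
    then show ?thesis using that g by (simp add: H.nat_pow_inv)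
  qed
  have P_sym: "P y x" if "P x y" for x y
    using that swap[of x y] unfolding P_def sym[of "\<beta> y" "\<beta> x"] by metis
  have "P x y"
  proof (induction "nat \<bar>y - x\<bar>" arbitrary: x y rule: less_induct)
    case less
    have main: "P x y" if le: "x \<le> y" and IH: "\<And>x' y'. \<bar>y' - x'\<bar> < y - x \<Longrightarrow> P x' y'" for x y
    proof -
      define k where "k = x + int n - 2"
      \<comment> \<open>For n = 4 and \<open>y = x + n - 3\<close> renaming would leave the distance
        at 1, hence the side condition; in the other distant cases it shrinks.\<close>
      consider "x = y" | "x < y" "y - x \<le> int n - 4" | "n = 4" "y = x + int n - 3"
        | "int n - 3 \<le> y - x" "y = x + int n - 3 \<longrightarrow> 4 < n" "A3 y"
        | "int n - 3 \<le> y - x" "y = x + int n - 3 \<longrightarrow> 4 < n" "A3 k"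
        | "int n - 3 \<le> y - x" "\<not> A3 y" "\<not> A3 k"
        using le n_gt by linarith
      then show ?thesis
      proof cases
        case 1
        then show ?thesis by (simp add: P_def)
      next
        case 2
        have "form (\<beta> x) (\<beta> y) = - cos (pi / real (coxeter_label W (a x) (a y)))"
          using form_near[of x y] 2 by (simp add: coxeter_form_simple_roots)
        moreover have "(g x \<otimes>\<^bsub>H\<^esub> g y) [^]\<^bsub>H\<^esub> coxeter_label W (a x) (a y) = \<one>\<^bsub>H\<^esub>"
          using 2 by (intro near) simp
        ultimately show ?thesis using label_near[OF 2] unfolding P_def by blast
      next
        case 3
        then show ?thesis using form_adjacent_le[of y x] by (simp add: P_def)
      next
        case 4
        have "P x (y + 2 - int n)" using 4 n_gt by (intro IH) linarith
        then show ?thesis using A3_root[OF 4(3)] A3[OF 4(3)] by (simp add: P_def)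
      next
        case 5
        have kx: "k + 2 - int n = x" by (simp add: k_def)
        have "P k y" using 5 n_gt unfolding k_def by (intro IH) linarith
        then show ?thesis using A3_root[OF 5(3)] A3[OF 5(3)] by (simp add: P_def kx)
      next
        case 6
        have f: "form (\<beta> x) (\<beta> y) = - Y y k (k + 2)"
          by (rule form_Y) (simp add: k_def)
        consider "y = x + int n - 3" | "y = k" "H3 y" | "y = k" "\<not> H3 y" | "k < y"
          using 6 unfolding k_def by linarith
        then show ?thesis
        proof cases
          case 1
          then have "k = y + 1" by (simp add: k_def)
          then show ?thesis using form_adjacent_le[of y x] 1 6 by (simp add: P_def)
        next
          case 2
          have yx: "y + 2 - int n = x" using 2 by (simp add: k_def)
          have "form (\<beta> x) (\<beta> y) = - cos (pi / real (2::nat))"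
            using f 2 Y_0_H3[of y] by simp
          moreover have "(g x \<otimes>\<^bsub>H\<^esub> g y) [^]\<^bsub>H\<^esub> (2::nat) = \<one>\<^bsub>H\<^esub>"
            using swap[OF H3[OF 2(2)]] by (simp only: yx)
          ultimately show ?thesis unfolding P_def by blast
        next
          case 3
          then show ?thesis using f Y_0_ge[of y] 6 by (simp add: P_def)
        next
          case 4
          then show ?thesis using f Y_far_ge[of y k] 6 by (simp add: P_def)
        qed
      qed
    qed
    show ?case
    proof (cases "x \<le> y")
      case True
      show ?thesis
        by (rule main[OF True], rule less) (use True in linarith)
    next
      case False
      then have "y \<le> x" by simp
      have "P y x"
        by (rule main[OF \<open>y \<le> x\<close>], rule less) (use False in linarith)
      then show ?thesis by (rule P_sym)
    qed
  qed
  then show ?thesis by (simp add: P_def)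
qed

text \<open>Every \<open>\<beta> j\<close> has nonnegative coordinates at all vertices far enough down the universal cover
  of the cycle, which gives a pointed cone containing all of them.\<close>

definition end_cone :: "('g \<Rightarrow> real) set" where
  "end_cone = {v. \<exists>l. \<forall>k\<le>l. \<forall>s. 0 \<le> \<rho> (inv (q k)) v s}"

lemma end_cone_pointed:
  assumes "v \<in> end_cone" "- v \<in> end_cone"
  shows "v = 0"
proof -
  obtain l where l: "\<And>k s. k \<le> l \<Longrightarrow> 0 \<le> \<rho> (inv (q k)) v s"
    using assms(1) by (auto simp: end_cone_def)
  obtain l' where l': "\<And>k s. k \<le> l' \<Longrightarrow> 0 \<le> \<rho> (inv (q k)) (- v) s"
    using assms(2) by (auto simp: end_cone_def)
  define k where "k = min l l'"
  have "\<rho> (inv (q k)) v = 0"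
    using l[of k] l'[of k] by (auto simp: fun_eq_iff k_def rep_minus intro: antisym)
  then show ?thesis using rep_inv'[of "q k" v] rep_scale[of "q k" 0 0] by simp
qed

lemma end_cone_add:
  assumes "u \<in> end_cone" "v \<in> end_cone"
  shows "u + v \<in> end_cone"
proof -
  obtain l where l: "\<And>k s. k \<le> l \<Longrightarrow> 0 \<le> \<rho> (inv (q k)) u s"
    using assms(1) by (auto simp: end_cone_def)
  obtain l' where l': "\<And>k s. k \<le> l' \<Longrightarrow> 0 \<le> \<rho> (inv (q k)) v s"
    using assms(2) by (auto simp: end_cone_def)
  have "0 \<le> \<rho> (inv (q k)) (u + v) s" if "k \<le> min l l'" for k s
    using l[of k s] l'[of k s] that by (simp add: rep_add)
  then show ?thesis unfolding end_cone_def by blast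
qed

lemma end_cone_scale: "\<lbrakk>0 \<le> r; v \<in> end_cone\<rbrakk> \<Longrightarrow> r *\<^sub>R v \<in> end_cone"
  by (auto simp: end_cone_def rep_scale) (metis mult_nonneg_nonneg)

lemma \<beta>_end_cone: "\<beta> y \<in> end_cone"
proof -
  have "0 \<le> \<rho> (inv (q k)) (\<beta> y) s" if "k \<le> y + int n - 2" for k s
    using tr_nonneg[OF that] by (simp add: tr_def)
  then show ?thesis unfolding end_cone_def by blast
qed

text \<open>From vertex \<open>max i j + 2\<close> the two elements are \<open>a i\<close> and
  \<open>a j\<close> conjugated by the same \<open>q k\<close>.\<close>

lemma \<sigma>_near:
  assumes "\<bar>i - j\<bar> \<le> int n - 4"
  shows "(\<sigma> i \<otimes> \<sigma> j) [^] coxeter_label W (a i) (a j) = \<one>"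
proof -
  define k where "k = max i j + 2"
  have "\<sigma> i = conjg (q k) (a i)" "\<sigma> j = conjg (q k) (a j)"
    using assms n_gt by (simp_all add: conjg_def \<sigma>_at k_def)
  then have "\<sigma> i \<otimes> \<sigma> j = conjg (q k) (a i \<otimes> a j)" by (simp add: conjg_mult)
  moreover have "conjg (q k) x [^] l = conjg (q k) (x [^] l)" if "x \<in> carrier W" for x and l :: nat
    using that by (induction l) (simp_all add: conjg_mult, simp add: conjg_def)
  ultimately show ?thesis
    by (simp add: coxeter_label_def pow_ord_eq_1) (simp add: conjg_def)
qed

lemma \<sigma>_square: "\<sigma> i \<otimes> \<sigma> i = \<one>"
  using \<sigma>_near[of i i] n_gt by (simp add: label_self)

lemma \<sigma>_A3: "A3 i \<Longrightarrow> \<sigma> i = \<sigma> (i + 2 - int n)"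
  by (rule faithful_eq) (simp_all add: \<sigma>_rep flip: A3_root)

text \<open>The two roots are orthogonal by \<open>Y_0_H3\<close>, so the reflections commute, and
  by faithfulness so do the elements.\<close>

lemma \<sigma>_H3:
  assumes "H3 i"
  shows "(\<sigma> i \<otimes> \<sigma> (i + 2 - int n)) [^] (2::nat) = \<one>"
proof -
  let ?j = "i + 2 - int n"
  have "form (\<beta> ?j) (\<beta> i) = 0"
    using form_Y[of ?j i i] Y_0_H3[OF assms] by simp
  then have "\<sigma> i \<otimes> \<sigma> ?j = \<sigma> ?j \<otimes> \<sigma> i"
    by (intro faithful_eq)
      (simp_all add: rep_mult \<sigma>_rep refl_def form_simps sym[of "\<beta> i" "\<beta> ?j"] algebra_simps)
  then have "\<sigma> i \<otimes> \<sigma> ?j \<otimes> (\<sigma> i \<otimes> \<sigma> ?j) = \<sigma> i \<otimes> \<sigma> i \<otimes> (\<sigma> ?j \<otimes> \<sigma> ?j)"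
    by (metis \<sigma>_closed m_assoc m_closed)
  then show ?thesis by (simp add: \<sigma>_square numeral_2_eq_2)
qed

lemma \<sigma>_relators:
  assumes rel: "r \<in> cycle_relators W n a"
  shows "word_val W \<sigma> r = \<one>"
proof -
  have \<sigma>: "\<sigma> \<in> UNIV \<rightarrow> carrier W" by simp
  consider i j where "r = word_pow [gen i, gen j] (coxeter_label W (a i) (a j))" "\<bar>i - j\<bar> \<le> int n - 4"
    | i where "r = word_pow [gen i, gen (i + 2 - int n)] 2" "H3 i"
    | i where "r = [gen i, gen_inv (i + 2 - int n)]" "A3 i"
    using rel unfolding cycle_relators_def type_A3_iff type_H3_iff by blast
  then show ?thesis
  proof cases
    case 1
    then show ?thesis using \<sigma>_near by (simp add: word_val_word_pow[OF \<sigma>])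
  next
    case 2
    then show ?thesis using \<sigma>_H3[OF 2(2)] by (simp add: word_val_word_pow[OF \<sigma>])
  next
    case 3
    then show ?thesis using \<sigma>_A3[OF 3(2)] by simp
  qed
qed

text \<open>The relators hold for \<sigma>, so the presented group maps onto \<open>W_Omega\<close>.
  Acting through this map it is a reflection group, hence acts faithfully, and so the map itself is
  injective.\<close>

theorem W_Omega_presentation:
  "has_presentation (W\<lparr>carrier := W_Omega W S (a base)\<rparr>) UNIV \<sigma> (cycle_relators W n a)"
proof -
  let ?R = "cycle_relators W n a"
  let ?P = "presented_group UNIV ?R"
  let ?g = "\<lambda>i. word_class UNIV ?R [gen i]"
  interpret P: group ?P by (rule group_presented_group)
  have words: "w \<in> words UNIV" for w :: "int word" by (simp add: words_def)
  obtain h where h: "h \<in> hom ?P W" "\<And>w. h (word_class UNIV ?R w) = word_val W \<sigma> w"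
    using presented_group_hom[of \<sigma> UNIV ?R] \<sigma>_relators words by auto
  have hg: "h (?g i) = \<sigma> i" for i by (simp add: h)
  have g: "?g i \<in> carrier ?P" for i by (simp add: carrier_presented_group words)
  have gf: "?g \<in> UNIV \<rightarrow> carrier ?P" using g by simp
  have rel: "word_val ?P ?g r = \<one>\<^bsub>?P\<^esub>" if "r \<in> ?R" for r
    using presented_group_relator[OF that words] .
  have near: "(?g i \<otimes>\<^bsub>?P\<^esub> ?g j) [^]\<^bsub>?P\<^esub> coxeter_label W (a i) (a j) = \<one>\<^bsub>?P\<^esub>"
    if "\<bar>i - j\<bar> \<le> int n - 4" for i j
  proof -
    have "word_pow [gen i, gen j] (coxeter_label W (a i) (a j)) \<in> ?R"
      using that unfolding cycle_relators_def by blast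
    from rel[OF this] show ?thesis using g by (simp add: P.word_val_word_pow[OF gf words])
  qed
  have H3: "(?g i \<otimes>\<^bsub>?P\<^esub> ?g (i + 2 - int n)) [^]\<^bsub>?P\<^esub> (2::nat) = \<one>\<^bsub>?P\<^esub>" if "H3 i" for i
  proof -
    have "word_pow [gen i, gen (i + 2 - int n)] 2 \<in> ?R"
      using that unfolding cycle_relators_def type_H3_iff by blast
    from rel[OF this] show ?thesis using g by (simp add: P.word_val_word_pow[OF gf words])
  qed
  have A3: "?g i = ?g (i + 2 - int n)" if "A3 i" for i
  proof -
    have "[gen i, gen_inv (i + 2 - int n)] \<in> ?R"
      using that unfolding cycle_relators_def type_A3_iff by blast
    from rel[OF this] have "?g i \<otimes>\<^bsub>?P\<^esub> inv\<^bsub>?P\<^esub> ?g (i + 2 - int n) = \<one>\<^bsub>?P\<^esub>"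
      using g by simp
    then show ?thesis using g by (metis P.inv_closed P.inv_equality P.inv_inv)
  qed
  have hc: "h u \<in> carrier W" if "u \<in> carrier ?P" for u using h(1) that by (auto simp: hom_def)
  interpret R: reflection_group form ?P UNIV ?g \<beta> "\<lambda>u. \<rho> (h u)" end_cone
  proof
    show "?g x \<otimes>\<^bsub>?P\<^esub> ?g x = \<one>\<^bsub>?P\<^esub>" for x
      using near[of x x] n_gt g by (simp add: label_self)
    show "generate ?P (range ?g) = carrier ?P" by (rule presented_group_generate)
    show "\<rho> (h \<one>\<^bsub>?P\<^esub>) v = v" for v
      using hom_one[OF h(1) P.group_axioms group_axioms] by (simp add: rep_one)
    show "\<rho> (h (u \<otimes>\<^bsub>?P\<^esub> w)) v = \<rho> (h u) (\<rho> (h w) v)" if "u \<in> carrier ?P" "w \<in> carrier ?P" for u w v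
      using hom_mult[OF h(1) that] hc that by (simp add: rep_mult)
    show "\<rho> (h (?g x)) v = refl (\<beta> x) v" for x v
      by (simp only: hg \<sigma>_rep)
    show "?g x = ?g y \<and> \<beta> x = \<beta> y \<or>
       (\<exists>l\<ge>2. (?g x \<otimes>\<^bsub>?P\<^esub> ?g y) [^]\<^bsub>?P\<^esub> (l::nat) = \<one>\<^bsub>?P\<^esub> \<and> form (\<beta> x) (\<beta> y) = - cos (pi / real l)) \<or>
       form (\<beta> x) (\<beta> y) \<le> - 1" for x y
      by (rule root_pair_cases[OF P.group_axioms g near H3 A3])
  qed (simp_all add: g end_cone_add end_cone_scale \<beta>_end_cone end_cone_pointed)
  have inj: "inj_on h (carrier ?P)"
  proof (rule inj_onI)
    fix u w assume "u \<in> carrier ?P" "w \<in> carrier ?P" "h u = h w"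
    then show "u = w" by (intro R.faithful_eq) simp_all
  qed
  interpret hom: group_hom ?P W h
    by (simp add: group_hom_def group_hom_axioms_def P.group_axioms group_axioms h(1))
  have img: "h ` carrier ?P = W_Omega W S (a base)"
  proof
    have "word_val W \<sigma> w \<in> generate W (range \<sigma>)" for w
    proof (induction w)
      case Nil
      show ?case by (simp add: generate.one)
    next
      case (Cons p w)
      then show ?case by (cases p) (auto intro: generate.intros)
    qed
    then show "h ` carrier ?P \<subseteq> W_Omega W S (a base)"
      unfolding W_Omega_generate by (auto simp: carrier_presented_group h)
    have "range \<sigma> \<subseteq> h ` carrier ?P" using g by (auto simp flip: hg)
    then show "W_Omega W S (a base) \<subseteq> h ` carrier ?P"
      unfolding W_Omega_generate by (intro generate_subgroup_incl hom.img_is_subgroup)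
  qed
  let ?W = "W\<lparr>carrier := W_Omega W S (a base)\<rparr>"
  have "h \<in> iso ?P ?W"
    using inj img h(1) by (auto simp: iso_def bij_betw_def hom_def)
  moreover have "group ?W"
    unfolding img[symmetric] by (intro subgroup.subgroup_is_group hom.img_is_subgroup group_axioms)
  ultimately show ?thesis
    unfolding has_presentation_def using words hg by blast
qed

end

theorem theorem14:
  fixes W :: "('g, 'm) monoid_scheme"
    and S :: "'g set" and s :: 'g and n :: nat and a :: "int \<Rightarrow> 'g"
  assumes "coxeter_system W S"
    and "n > 3"
    and "odd_cycle_diagram W S n a"
    and "s \<in> S"
  shows "\<exists>\<sigma> :: int \<Rightarrow> 'g.
    has_presentation (W\<lparr>carrier := W_Omega W S s\<rparr>) UNIV \<sigma> (cycle_relators W n a) \<and>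
    (\<exists>c \<in> Gamma_Omega W S s. generate W {c} = Gamma_Omega W S s \<and>
       (\<forall>i. c \<otimes>\<^bsub>W\<^esub> \<sigma> i \<otimes>\<^bsub>W\<^esub> inv\<^bsub>W\<^esub> c = \<sigma> (i + int n)))"
proof -
  have range: "range a = S" and eq: "\<And>i j. a i = a j \<longleftrightarrow> [i = j] (mod int n)"
    using assms(3) by (auto simp: odd_cycle_diagram_def)
  obtain base where base: "s = a base" using assms(4) range by auto
  \<comment> \<open>Finiteness comes first, since the Coxeter form is a sum over \<open>S\<close>
    and the locale \<open>odd_cycle\<close> already presupposes the representation.\<close>
  have "S \<subseteq> a ` {0..<int n}"
  proof
    fix t assume "t \<in> S"
    then obtain i where "t = a i" using range by auto
    moreover have "a i = a (i mod int n)" by (simp add: eq cong_def)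
    ultimately show "t \<in> a ` {0..<int n}" using assms(2) by simp
  qed
  then have "finite S" by (rule finite_subset) simp
  then obtain \<rho> where
    "reflection_group (coxeter_form W S) W S (\<lambda>s. s) simple_root \<rho> {v. \<forall>x. 0 \<le> v x}"
    using coxeter_reflection_group[OF assms(1)] by blast
  then interpret reflection_group "coxeter_form W S" W S "\<lambda>s. s" simple_root \<rho> "{v. \<forall>x. 0 \<le> v x}" .
  interpret odd_cycle W S \<rho> n a base
    by standard (use assms in auto)
  show ?thesis
    using W_Omega_presentation Gamma_Omega_loop \<sigma>_period unfolding base by metis
qed

end
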